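(* Let $n \geq 1$ be an integer and let $K \in C(\mathbb{R}^{2n})$, $K \not\equiv 0$, satisfy the polynomial growth condition $$|K(x)| \leq C(|x|^\lambda + 1) \quad \text{in } \mathbb{R}^{2n}, \quad \text{for some } C > 0,\ \lambda \geq 0.$$ Let $u$ be a solution to $$(-\Delta)^n u = K(x)e^{2nu} \quad \text{in } \mathbb{R}^{2n}$$ satisfying $u(x) = O(\ln|x|)$ as $|x| \to \infty$. Then: (1) If $K$ has constant sign at infinity, then $K e^{2nu} \in L^1(\mathbb{R}^{2n})$, i.e. the conformal metric $g_u = e^{2u}|dx|^2$ has finite total curvature $\Lambda_u$. (2) If $K e^{2nu} \in L^1(\mathbb{R}^{2n})$, then $$\lim_{|x|\to \infty}\frac{u(x)}{\ln|x|} = - \frac{\Lambda_u}{\gamma_n} = -\frac{1}{\gamma_n}\int_{\mathbb{R}^{2n}} K(x)e^{2nu(x)}\,dx.$$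
   Context: $\gamma_n := \frac{(2n-1)!}{2}|S^{2n}| = 2^{2n-1}(n-1)!\,\pi^n$. When $Ke^{2nu}\in L^1(\mathbb{R}^{2n})$, the total curvature is $\Lambda_u := \int_{\mathbb{R}^{2n}} K e^{2nu}\,dx$. "Constant sign at infinity" means that there is $R>0$ such that $K\ge 0$ on $\{|x|\ge R\}$ or $K\le 0$ on $\{|x|\ge R\}$. A solution is a continuous function satisfying the equation in the sense of distributions. *)

theory Defs
  imports "HOL-Analysis.Analysis" "HOL-Library.Landau_Symbols"
begin

primrec C_k :: "nat \<Rightarrow> ('a::euclidean_space \<Rightarrow> real) \<Rightarrow> bool" where
  "C_k 0 f \<longleftrightarrow> continuous_on UNIV f"
| "C_k (Suc k) f \<longleftrightarrow>
     (\<forall>x. f differentiable at x) \<and> (\<forall>v. C_k k (\<lambda>x. frechet_derivative f (at x) v))"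

definition test_function :: "('a::euclidean_space \<Rightarrow> real) \<Rightarrow> bool" where
  "test_function \<phi> \<longleftrightarrow> (\<forall>k. C_k k \<phi>) \<and> compact (closure {x. \<phi> x \<noteq> 0})"

definition partial_deriv :: "'a::euclidean_space \<Rightarrow> ('a \<Rightarrow> real) \<Rightarrow> 'a \<Rightarrow> real" where
  "partial_deriv b f x = frechet_derivative f (at x) b"

definition laplacian :: "('a::euclidean_space \<Rightarrow> real) \<Rightarrow> 'a \<Rightarrow> real" where
  "laplacian f x = (\<Sum>b\<in>Basis. partial_deriv b (partial_deriv b f) x)"

definition neg_laplacian_power :: "nat \<Rightarrow> ('a::euclidean_space \<Rightarrow> real) \<Rightarrow> 'a \<Rightarrow> real" where
  "neg_laplacian_power n f = ((\<lambda>g x. - laplacian g x) ^^ n) f"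

text \<open>The sign \<open>(-1)^(2n) = 1\<close> from moving the \<open>2n\<close> derivatives to the test function is absorbed.
  For continuous \<open>u\<close> and \<open>K\<close> both integrands below are continuous with compact support,
  hence integrable.\<close>

definition conformal_solution ::
  "nat \<Rightarrow> ('a::euclidean_space \<Rightarrow> real) \<Rightarrow> ('a \<Rightarrow> real) \<Rightarrow> bool" where
  "conformal_solution n K u \<longleftrightarrow>
     continuous_on UNIV u \<and>
     (\<forall>\<phi>. test_function \<phi> \<longrightarrow>
        (LINT x|lborel. u x * neg_laplacian_power n \<phi> x) =
        (LINT x|lborel. K x * exp (2 * real n * u x) * \<phi> x))"

definition constant_sign_at_infinity :: "('a::real_normed_vector \<Rightarrow> real) \<Rightarrow> bool" where
  "constant_sign_at_infinity K \<longleftrightarrow>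
     (\<exists>R>0. (\<forall>x. norm x \<ge> R \<longrightarrow> K x \<ge> 0) \<or> (\<forall>x. norm x \<ge> R \<longrightarrow> K x \<le> 0))"

definition total_curvature ::
  "nat \<Rightarrow> ('a::euclidean_space \<Rightarrow> real) \<Rightarrow> ('a \<Rightarrow> real) \<Rightarrow> real" where
  "total_curvature n K u = (LINT x|lborel. K x * exp (2 * real n * u x))"

text \<open>Surface measure of the unit sphere \<open>S^d\<close> in \<open>R^(d+1)\<close>, as \<open>d + 1\<close> times the volume of
  the unit ball it bounds.\<close>

definition sphere_area :: "nat \<Rightarrow> real" where
  "sphere_area d = real (d + 1) * unit_ball_vol (real (d + 1))"

definition gamma_const :: "nat \<Rightarrow> real" where
  "gamma_const n = fact (2 * n - 1) / 2 * sphere_area (2 * n)"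

lemma gamma_const_closed_form:
  assumes "n \<ge> 1"
  shows "gamma_const n = 2 ^ (2 * n - 1) * fact (n - 1) * pi ^ n"
proof -
  obtain m where m: "n = Suc m"
    using assms by (cases n) auto
  have cancel: "4 * P * ((1 + N) * F) * Q / ((2 + 2 * N) * ((1 + 2 * N) * G)) =
      2 * P * F * Q / ((1 + 2 * N) * G)"
    if "N \<ge> 0" "G \<noteq> 0" for P N F Q G :: real
  proof -
    have "4 * P * ((1 + N) * F) * Q / ((2 + 2 * N) * ((1 + 2 * N) * G)) =
        ((2 * (1 + N)) * (2 * P * F * Q)) / ((2 * (1 + N)) * ((1 + 2 * N) * G))"
      by (simp add: algebra_simps)
    then show ?thesis
      using that by (simp add: mult_ac del: distrib_left_numeral)
  qed
  have vol: "unit_ball_vol (real (2 * n + 1)) =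
      2 ^ (2 * n + 1) * fact n / fact (2 * n + 1) * pi ^ n"
    using unit_ball_vol_odd[of n] cancel by simp
  have "fact (2 * n + 1) = real (2 * n + 1) * (real (2 * n) * fact (2 * n - 1))"
    by (simp add: m algebra_simps)
  moreover have "fact n = real n * fact (n - 1)"
    by (simp add: m)
  moreover have "(2::real) ^ (2 * n + 1) = 4 * 2 ^ (2 * n - 1)"
    by (simp add: m)
  moreover have "real (2 * n + 1) \<noteq> 0" "real n \<noteq> 0" "fact (2 * n - 1) \<noteq> (0::real)"
    by (simp_all add: m)
  ultimately show ?thesis
    unfolding gamma_const_def sphere_area_def vol by (simp add: divide_simps)
qed

end

theory Submission
  imports Defs
begin

text \<open>In dimension \<open>2 n\<close> the function \<open>- ln |x|\<close> is \<open>\<gamma>\<^sub>n\<close> times a fundamental solution of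
  \<open>(- \<Delta>)\<^sup>n\<close>. Smooth it in the unit ball to \<open>\<Phi>\<close>; then
  \<open>\<Phi>((y - x) / s) - \<Phi>((y - x) / t) + ln (t / s)\<close> is a test function, and \<open>(- \<Delta>)\<^sup>n\<close> maps it to
  the difference of a bump of mass \<open>\<gamma>\<^sub>n\<close> at scale \<open>s\<close> and one at scale \<open>t\<close> around \<open>x\<close>. Hence the averages
  \<open>A(s, x)\<close> of \<open>u\<close> against these bumps satisfy
  \<open>A(s, x) - A(t, x) = \<integral> K e\<^bsup>2nu\<^esup> ln (t / |y - x|)\<close> up to the truncations at scales \<open>s\<close> and \<open>t\<close>.

  For (1) take \<open>x = 0\<close>, \<open>s = 1\<close>, divide by \<open>ln t\<close> and use Fatou's lemma.
  For (2) put \<open>r = |x|\<close>, \<open>t = r\<^sup>2\<close> and \<open>s = r\<^bsup>-q\<^esup>\<close> with \<open>q\<close> large. By dominated convergence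
  \<open>A(s, x) - A(t, x) \<sim> \<Lambda> ln r\<close> and \<open>A(1, 0) - A(t, 0) \<sim> 2 \<Lambda> ln r\<close>, while
  \<open>A(t, x) - A(t, 0) = o(ln r)\<close> and \<open>A(s, x) = \<gamma>\<^sub>n u(x) + O(1)\<close>. Together these give
  \<open>\<gamma>\<^sub>n u(x) \<sim> - \<Lambda> ln r\<close>.\<close>

section \<open>Smooth functions\<close>

text \<open>\<open>frechet_derivative\<close> is a choice operator. Uniqueness of derivatives lets
  any explicit derivative stand in for it, so closure under the usual operations reduces to the
  differentiation rules.\<close>

lemma C_k_SucI:
  assumes "\<And>x. (f has_derivative f' x) (at x)" and "\<And>v. C_k k (\<lambda>x. f' x v)"
  shows "C_k (Suc k) f"
proof -
  have "frechet_derivative f (at x) = f' x" for x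
    using frechet_derivative_at[OF assms(1)] by simp
  with assms show ?thesis by (auto simp: differentiable_def)
qed

lemma C_k_SucE:
  assumes "C_k (Suc k) f"
  obtains f' where "\<And>x. (f has_derivative f' x) (at x)" and "\<And>v. C_k k (\<lambda>x. f' x v)"
  using assms frechet_derivative_works[of f]
  by (intro that[of "\<lambda>x. frechet_derivative f (at x)"]) simp_all

lemma C_k_Suc_imp: "C_k (Suc k) f \<Longrightarrow> C_k k f"
proof (induction k arbitrary: f)
  case 0
  then have "f differentiable at x" for x by simp
  then show ?case
    by (simp add: continuous_at_imp_continuous_on differentiable_imp_continuous_within)
next
  case (Suc k)
  then show ?case by (metis C_k.simps(2))
qed

lemma C_k_const: "C_k k (\<lambda>x::'a::euclidean_space. c)"
proof (induction k arbitrary: c)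
  case (Suc k)
  show ?case by (rule C_k_SucI[where f' = "\<lambda>x v. 0"]) (auto intro: Suc)
qed simp

lemma C_k_inner: "C_k k (\<lambda>x::'a::euclidean_space. x \<bullet> v)"
proof (cases k)
  case 0
  then show ?thesis by (auto intro!: continuous_intros)
next
  case (Suc j)
  show ?thesis unfolding Suc
    by (rule C_k_SucI[where f' = "\<lambda>x w. w \<bullet> v"])
      (auto intro!: derivative_eq_intros C_k_const)
qed

lemma C_k_add: "C_k k f \<Longrightarrow> C_k k g \<Longrightarrow> C_k k (\<lambda>x. f x + g x)"
proof (induction k arbitrary: f g)
  case 0
  then show ?case by (auto intro!: continuous_intros)
next
  case (Suc k)
  obtain f' where f: "\<And>x. (f has_derivative f' x) (at x)" "\<And>v. C_k k (\<lambda>x. f' x v)"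
    by (rule C_k_SucE[OF Suc.prems(1)]) (rule that)
  obtain g' where g: "\<And>x. (g has_derivative g' x) (at x)" "\<And>v. C_k k (\<lambda>x. g' x v)"
    by (rule C_k_SucE[OF Suc.prems(2)]) (rule that)
  show ?case
    by (rule C_k_SucI[OF has_derivative_add[OF f(1) g(1)] Suc.IH[OF f(2) g(2)]])
qed

lemma C_k_mult: "C_k k f \<Longrightarrow> C_k k g \<Longrightarrow> C_k k (\<lambda>x. f x * g x)"
proof (induction k arbitrary: f g)
  case 0
  then show ?case by (auto intro!: continuous_intros)
next
  case (Suc k)
  obtain f' where f: "\<And>x. (f has_derivative f' x) (at x)" "\<And>v. C_k k (\<lambda>x. f' x v)"
    by (rule C_k_SucE[OF Suc.prems(1)]) (rule that)
  obtain g' where g: "\<And>x. (g has_derivative g' x) (at x)" "\<And>v. C_k k (\<lambda>x. g' x v)"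
    by (rule C_k_SucE[OF Suc.prems(2)]) (rule that)
  show ?case
    by (rule C_k_SucI[OF has_derivative_mult[OF f(1) g(1)]])
      (intro C_k_add Suc.IH f(2) g(2) Suc.prems[THEN C_k_Suc_imp])
qed

lemma C_k_uminus: "C_k k f \<Longrightarrow> C_k k (\<lambda>x. - f x)"
  using C_k_mult[OF C_k_const[of k "-1"], of f] by simp

lemma C_k_diff: "C_k k f \<Longrightarrow> C_k k g \<Longrightarrow> C_k k (\<lambda>x. f x - g x)"
  using C_k_add[OF _ C_k_uminus, of k f g] by simp

text \<open>The derivative of 1/f is -(1/f) f' (1/f), so the induction keeps f fixed and reuses the
  hypothesis for 1/f one order lower.\<close>

lemma C_k_inverse:
  assumes "\<And>x. f x \<noteq> 0"
  shows "C_k k f \<Longrightarrow> C_k k (\<lambda>x. inverse (f x))"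
proof (induction k)
  case 0
  then show ?case by (auto intro!: continuous_intros simp: assms)
next
  case (Suc k)
  obtain f' where f: "\<And>x. (f has_derivative f' x) (at x)" "\<And>v. C_k k (\<lambda>x. f' x v)"
    by (rule C_k_SucE[OF Suc.prems(1)]) (rule that)
  have IH: "C_k k (\<lambda>x. inverse (f x))"
    using Suc C_k_Suc_imp by blast
  show ?case
    by (rule C_k_SucI[OF Deriv.has_derivative_inverse[OF assms f(1)]])
      (intro C_k_uminus C_k_mult IH f(2))
qed

lemma C_k_ln:
  assumes pos: "\<And>x. f x > (0::real)" and f: "C_k k f"
  shows "C_k k (\<lambda>x. ln (f x))"
proof (cases k)
  case 0
  have "f x \<noteq> 0" for x using pos[of x] by simp
  then show ?thesis using f 0
    by (auto intro!: continuous_on_ln)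
next
  case (Suc j)
  obtain f' where f': "\<And>x. (f has_derivative f' x) (at x)" "\<And>v. C_k j (\<lambda>x. f' x v)"
    by (rule C_k_SucE[OF f[unfolded Suc]]) (rule that)
  have "f x \<noteq> 0" for x using pos[of x] by simp
  then have "C_k j (\<lambda>x. inverse (f x))"
    by (rule C_k_inverse) (use f C_k_Suc_imp Suc in blast)
  then show ?thesis unfolding Suc
    by (intro C_k_SucI[OF DERIV_compose_FDERIV[OF DERIV_ln[OF pos] f'(1)]] C_k_mult f'(2))
qed

lemma C_k_SucI_real:
  assumes "\<And>t. (H has_real_derivative H' t) (at t)" and "C_k k H'"
  shows "C_k (Suc k) H"
proof (rule C_k_SucI)
  show "(H has_derivative (\<lambda>h. H' x * h)) (at x)" for x
    using assms(1) by (simp add: has_field_derivative_def)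
  show "C_k k (\<lambda>x. H' x * v)" for v
    by (intro C_k_mult assms(2) C_k_const)
qed

lemma C_k_Suc_deriv:
  fixes H :: "real \<Rightarrow> real"
  assumes "C_k (Suc k) H"
  shows "(H has_real_derivative deriv H t) (at t)" and "C_k k (deriv H)"
proof -
  obtain f' where f: "\<And>x. (H has_derivative f' x) (at x)" "\<And>v. C_k k (\<lambda>x. f' x v)"
    by (rule C_k_SucE[OF assms(1)]) (rule that)
  have "f' x h = f' x 1 * h" for x h
    using linear_scale[OF has_derivative_linear[OF f(1)[of x]], of h 1] by (simp add: mult.commute)
  then have "f' x = (*) (f' x 1)" for x
    by blast
  with f(1) have D: "(H has_real_derivative f' x 1) (at x)" for x
    unfolding has_field_derivative_def by metis
  then have "deriv H = (\<lambda>x. f' x 1)"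
    by (auto intro: DERIV_imp_deriv)
  with D f(2) show "(H has_real_derivative deriv H t) (at t)" "C_k k (deriv H)"
    by auto
qed

text \<open>The squared norm is a polynomial, so no smoothness is lost at the centre. A directional
  derivative is an affine function times \<open>deriv H\<close> of the same squared norm, which is
  why the induction generalises over \<open>H\<close>.\<close>

lemma C_k_radial:
  fixes a :: "'a::euclidean_space"
  shows "C_k k H \<Longrightarrow> C_k k (\<lambda>x. H ((norm (x - a))\<^sup>2))"
proof (induction k arbitrary: H)
  case 0
  then have "continuous_on UNIV H" by simp
  then show ?case
    by (simp, rule continuous_on_compose2) (auto intro!: continuous_intros)
next
  case (Suc k)
  note H = C_k_Suc_deriv[OF Suc.prems]
  have "((\<lambda>x. H ((norm (x - a))\<^sup>2)) has_derivative
      (\<lambda>v. (2 * (x \<bullet> v) - 2 * (a \<bullet> v)) * deriv H ((norm (x - a))\<^sup>2))) (at x)" for x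
  proof -
    have "((\<lambda>x. (norm (x - a))\<^sup>2) has_derivative (\<lambda>v. 2 * (x \<bullet> v) - 2 * (a \<bullet> v))) (at x)"
      unfolding power2_norm_eq_inner
      by (auto intro!: derivative_eq_intros simp: algebra_simps inner_commute)
    from DERIV_compose_FDERIV[OF H(1) this] show ?thesis .
  qed
  then show ?case
    by (rule C_k_SucI) (intro C_k_mult C_k_diff C_k_const C_k_inner Suc.IH H(2))
qed

definition smooth :: "('a::euclidean_space \<Rightarrow> real) \<Rightarrow> bool" where
  "smooth f \<longleftrightarrow> (\<forall>k. C_k k f)"

lemma smooth_continuous: "smooth f \<Longrightarrow> continuous_on UNIV f"
  unfolding smooth_def using C_k.simps(1) by blast

lemma smooth_deriv:
  assumes "smooth H"
  shows "(H has_real_derivative deriv H t) (at t)" and "smooth (deriv H)"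
proof -
  have H: "C_k (Suc k) H" for k
    using assms unfolding smooth_def by blast
  show "(H has_real_derivative deriv H t) (at t)" "smooth (deriv H)"
    unfolding smooth_def by (rule C_k_Suc_deriv[OF H], intro allI C_k_Suc_deriv(2)[OF H])
qed

section \<open>Flat functions and a smooth logarithm\<close>

definition flat :: "real poly \<Rightarrow> real \<Rightarrow> real" where
  "flat p t = (if t \<le> 0 then 0 else poly p (inverse t) * exp (- inverse t))"

text \<open>The factor s^m serves the induction: passing from p to \<open>pCons c p\<close> raises
  it by one power.\<close>

lemma poly_times_exp_tendsto_0: "((\<lambda>s. s ^ m * poly p s * exp (- s)) \<longlongrightarrow> (0::real)) at_top"
proof (induction p arbitrary: m)
  case (pCons c p)
  have "((\<lambda>s. c * (s ^ m / exp s) + s ^ Suc m * poly p s * exp (- s)) \<longlongrightarrow> c * 0 + 0) at_top"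
    by (intro tendsto_intros tendsto_power_div_exp_0 pCons.IH)
  then show ?case by (simp add: algebra_simps exp_minus divide_inverse)
qed simp

lemma flat_tendsto_0: "(flat p \<longlongrightarrow> 0) (at 0)"
proof -
  have "((\<lambda>t. poly p (inverse t) * exp (- inverse t)) \<longlongrightarrow> 0) (at_right 0)"
    by (rule filterlim_compose[OF _ filterlim_inverse_at_top_right])
      (use poly_times_exp_tendsto_0[of 0 p] in simp)
  then have "(flat p \<longlongrightarrow> 0) (at_right 0)"
    by (rule filterlim_cong[THEN iffD1, rotated -1])
      (auto simp: flat_def eventually_at_filter divide_inverse)
  moreover have "(flat p \<longlongrightarrow> 0) (at_left 0)"
    by (rule tendsto_eventually) (auto simp: flat_def eventually_at_filter)
  ultimately show ?thesis by (simp add: filterlim_split_at)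
qed

text \<open>By the chain rule the derivative of p(1/t) exp(-1/t) is (1/t)^2 (p - p')(1/t) exp(-1/t).
  Carrying a polynomial thus makes the family closed under differentiation;
  \<open>[:0, 0, 1:]\<close> is the square of the variable.\<close>

lemma flat_has_real_derivative:
  "(flat p has_real_derivative flat ([:0, 0, 1:] * (p - pderiv p)) t) (at t)"
proof -
  consider "t < 0" | "t > 0" | "t = 0" by linarith
  then show ?thesis
  proof cases
    case 1
    then have "((\<lambda>_. 0) has_real_derivative flat ([:0, 0, 1:] * (p - pderiv p)) t) (at t)"
      by (simp add: flat_def)
    moreover have "\<forall>\<^sub>F s in nhds t. flat p s = 0"
      using eventually_nhds_in_open[of "{..<0}" t] 1
      by (auto elim!: eventually_mono simp: flat_def)
    ultimately show ?thesis by (rule DERIV_cong_ev[OF refl _ refl, THEN iffD2, rotated])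
  next
    case 2
    have q: "(inverse has_real_derivative - (inverse t * inverse t)) (at t)"
      using DERIV_inverse[of t UNIV] 2 by simp
    have "((\<lambda>t. poly p (inverse t) * exp (- inverse t)) has_real_derivative
        flat ([:0, 0, 1:] * (p - pderiv p)) t) (at t)"
      by (rule DERIV_cong[OF DERIV_mult[OF DERIV_chain2[OF poly_DERIV q]
            DERIV_chain2[OF DERIV_exp DERIV_minus[OF q]]]])
        (use 2 in \<open>simp add: flat_def algebra_simps\<close>)
    moreover have "\<forall>\<^sub>F s in nhds t. flat p s = poly p (inverse s) * exp (- inverse s)"
      using eventually_nhds_in_open[of "{0<..}" t] 2
      by (auto elim!: eventually_mono simp: flat_def)
    ultimately show ?thesis by (rule DERIV_cong_ev[OF refl _ refl, THEN iffD2, rotated])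
  next
    case 3
    \<comment> \<open>Dividing by h multiplies the polynomial in 1/h by its variable, so the
      difference quotient at 0 is again a flat function and tends to 0.\<close>
    have "(flat p h - flat p 0) / (h - 0) = flat ([:0, 1:] * p) h" for h
      by (simp add: flat_def divide_inverse)
    then have "(\<lambda>h. (flat p h - flat p 0) / (h - 0)) = flat ([:0, 1:] * p)"
      by blast
    then show ?thesis unfolding has_field_derivative_iff 3
      using flat_tendsto_0[of "[:0, 1:] * p"] by (simp only: flat_def[of _ 0] order.refl if_True)
  qed
qed

lemma C_k_flat: "C_k k (flat p)"
proof (induction k arbitrary: p)
  case 0
  then show ?case
    by (auto intro!: continuous_at_imp_continuous_on DERIV_isCont flat_has_real_derivative)
next
  case (Suc k)
  show ?case by (rule C_k_SucI_real[OF flat_has_real_derivative Suc])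
qed

lemma C_k_compose_affine:
  fixes H :: "real \<Rightarrow> real"
  shows "C_k k H \<Longrightarrow> C_k k (\<lambda>t. H (c * t + d))"
proof (induction k arbitrary: H)
  case 0
  then have "continuous_on UNIV H" by simp
  then show ?case
    by (simp, rule continuous_on_compose2) (auto intro!: continuous_intros)
next
  case (Suc k)
  note H = C_k_Suc_deriv[OF Suc.prems]
  have "((\<lambda>t. H (c * t + d)) has_real_derivative deriv H (c * t + d) * c) (at t)" for t
    by (rule DERIV_chain2[OF H(1)]) (auto intro!: derivative_eq_intros)
  then show ?case
    by (rule C_k_SucI_real) (intro C_k_mult C_k_const Suc.IH H(2))
qed

text \<open>Positive on the whole line because \<open>3 / exp 1 > 1\<close>, and equal to \<open>t\<close> for \<open>t \<ge> 1\<close>: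
  its logarithm is a smooth function that agrees with \<open>ln\<close> there, and no mollification is needed.\<close>

definition cutoff :: "real \<Rightarrow> real" where
  "cutoff t = t + 3 * (1 + t * t) * flat 1 (-1 * t + 1)"

lemma cutoff_ge_1: "t \<ge> 1 \<Longrightarrow> cutoff t = t"
  by (simp add: cutoff_def flat_def)

lemma cutoff_ge_self: "cutoff t \<ge> t"
  by (auto simp: cutoff_def flat_def)

text \<open>For t \<le> 0 the argument 1 - t is at least 1, so \<open>flat 1 (1 - t)\<close> is at
  least exp(-1) \<ge> 1/3 and \<open>cutoff t\<close> is at least t + 1 + t^2 > 0.\<close>

lemma cutoff_pos: "cutoff t > 0"
proof (cases "t > 0")
  case True
  then show ?thesis using cutoff_ge_self[of t] by simp
next
  case False
  have "3 * flat 1 (1 - t) \<ge> 1"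
  proof -
    have "inverse 3 \<le> inverse (exp (1::real))"
      by (rule le_imp_inverse_le[OF exp_le exp_gt_zero])
    also have "\<dots> = exp (-1)" by (simp add: exp_minus)
    also have "\<dots> \<le> flat 1 (1 - t)"
      using False by (simp add: flat_def inverse_le_1_iff)
    finally show ?thesis by simp
  qed
  then have "(1 + t * t) * 1 \<le> (1 + t * t) * (3 * flat 1 (1 - t))"
    by (intro mult_left_mono) auto
  moreover have "t + (1 + t * t) > 0"
    using zero_le_square[of "t + 1/2"] by (auto simp: algebra_simps)
  ultimately show ?thesis by (simp add: cutoff_def algebra_simps)
qed

definition smooth_ln :: "real \<Rightarrow> real" where
  "smooth_ln t = ln (cutoff t)"

lemma C_k_ident: "C_k k (\<lambda>t::real. t)"
  using C_k_inner[of k "1::real"] by simp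

lemma smooth_smooth_ln: "smooth smooth_ln"
proof -
  have "C_k k smooth_ln" for k
    unfolding smooth_ln_def[abs_def]
    by (intro C_k_ln cutoff_pos, unfold cutoff_def[abs_def])
      (intro C_k_add C_k_mult C_k_const C_k_ident C_k_compose_affine C_k_flat)
  then show ?thesis by (simp add: smooth_def)
qed

lemma smooth_ln_eq: "t \<ge> 1 \<Longrightarrow> smooth_ln t = ln t"
  by (simp add: smooth_ln_def cutoff_ge_1)

text \<open>This one-sided comparison is the source of the sign in
  \<open>tlog_nonneg\<close>.\<close>

lemma smooth_ln_ge: "t > 0 \<Longrightarrow> smooth_ln t \<ge> ln t"
  unfolding smooth_ln_def using cutoff_ge_self cutoff_pos by simp

lemma smooth_ln_bounded: "\<exists>M>0. \<forall>t\<in>{0..1}. \<bar>smooth_ln t\<bar> \<le> M"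
proof -
  have "compact (smooth_ln ` {0..1})"
    by (intro compact_continuous_image continuous_on_subset[OF smooth_continuous[OF smooth_smooth_ln]]) auto
  then show ?thesis
    using bounded_pos[THEN iffD1, OF compact_imp_bounded] by (fastforce simp: image_iff)
qed

section \<open>Powers of the Laplacian on radial functions\<close>

lemma smooth_const: "smooth (\<lambda>x. c)"
  by (simp add: smooth_def C_k_const)

lemma smooth_add: "smooth f \<Longrightarrow> smooth g \<Longrightarrow> smooth (\<lambda>x. f x + g x)"
  by (simp add: smooth_def C_k_add)

lemma smooth_mult: "smooth f \<Longrightarrow> smooth g \<Longrightarrow> smooth (\<lambda>x. f x * g x)"
  by (simp add: smooth_def C_k_mult)

lemma smooth_uminus: "smooth f \<Longrightarrow> smooth (\<lambda>x. - f x)"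
  by (simp add: smooth_def C_k_uminus)

lemma smooth_scale: "smooth H \<Longrightarrow> smooth (\<lambda>t. H (c * t))" for H :: "real \<Rightarrow> real"
  using C_k_compose_affine[of _ H c 0] by (simp add: smooth_def)

text \<open>The radial form of \<open>- \<Delta>\<close> in dimension \<open>2 n\<close>, in the variable \<open>t = |x|\<^sup>2\<close>.\<close>

definition radial_op :: "nat \<Rightarrow> (real \<Rightarrow> real) \<Rightarrow> real \<Rightarrow> real" where
  "radial_op n H t = - (4 * t * deriv (deriv H) t + 4 * real n * deriv H t)"

lemma smooth_radial_op: "smooth H \<Longrightarrow> smooth (radial_op n H)"
  unfolding radial_op_def[abs_def]
  by (intro smooth_uminus smooth_add smooth_mult smooth_const smooth_deriv)
    (simp_all add: smooth_def C_k_ident)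

lemma smooth_radial_op_funpow: "smooth H \<Longrightarrow> smooth ((radial_op n ^^ m) H)"
  by (induction m) (auto intro: smooth_radial_op)

lemma has_derivative_radial:
  fixes a :: "'a::euclidean_space"
  assumes "smooth H"
  shows "((\<lambda>x. H ((norm (x - a))\<^sup>2)) has_derivative
    (\<lambda>v. 2 * ((x - a) \<bullet> v) * deriv H ((norm (x - a))\<^sup>2))) (at x)"
proof -
  have "((\<lambda>x. (norm (x - a))\<^sup>2) has_derivative (\<lambda>v. 2 * ((x - a) \<bullet> v))) (at x)"
    unfolding power2_norm_eq_inner
    by (auto intro!: derivative_eq_intros simp: algebra_simps inner_commute)
  from DERIV_compose_FDERIV[OF smooth_deriv(1)[OF assms] this] show ?thesis .
qed

text \<open>The second derivative in direction b is 2 H' + 4 H'' ((x - a) . b)^2. Summed over the 2n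
  basis vectors, the squares give t = |x - a|^2 and the first terms give 4 n H'.\<close>

lemma laplacian_radial:
  fixes a :: "'a::euclidean_space"
  assumes H: "smooth H" and dim: "DIM('a) = 2 * n"
  shows "- laplacian (\<lambda>x. H ((norm (x - a))\<^sup>2)) x = radial_op n H ((norm (x - a))\<^sup>2)"
proof -
  note D = has_derivative_radial[OF H, of a]
  note D' = has_derivative_radial[OF smooth_deriv(2)[OF H], of a]
  have "partial_deriv b (\<lambda>x. H ((norm (x - a))\<^sup>2)) =
      (\<lambda>x. 2 * ((x - a) \<bullet> b) * deriv H ((norm (x - a))\<^sup>2))" for b
    using frechet_derivative_at[OF D] by (simp add: partial_deriv_def fun_eq_iff)
  moreover have "partial_deriv b (\<lambda>x. 2 * ((x - a) \<bullet> b) * deriv H ((norm (x - a))\<^sup>2)) x =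
      2 * deriv H ((norm (x - a))\<^sup>2) +
      4 * deriv (deriv H) ((norm (x - a))\<^sup>2) * (((x - a) \<bullet> b) * ((x - a) \<bullet> b))"
    if "b \<in> Basis" for b
  proof -
    have "((\<lambda>x. 2 * ((x - a) \<bullet> b)) has_derivative (\<lambda>v. 2 * (v \<bullet> b))) (at x)"
      by (auto intro!: derivative_eq_intros)
    then have "partial_deriv b (\<lambda>x. 2 * ((x - a) \<bullet> b) * deriv H ((norm (x - a))\<^sup>2)) x =
        2 * ((x - a) \<bullet> b) * (2 * ((x - a) \<bullet> b) * deriv (deriv H) ((norm (x - a))\<^sup>2)) +
        2 * (b \<bullet> b) * deriv H ((norm (x - a))\<^sup>2)"
      unfolding partial_deriv_def
      by (rule fun_cong[OF frechet_derivative_at[OF has_derivative_mult[OF _ D']], symmetric])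
    with that show ?thesis by simp
  qed
  ultimately have "laplacian (\<lambda>x. H ((norm (x - a))\<^sup>2)) x =
      (\<Sum>b\<in>(Basis::'a set). 2 * deriv H ((norm (x - a))\<^sup>2) +
      4 * deriv (deriv H) ((norm (x - a))\<^sup>2) * (((x - a) \<bullet> b) * ((x - a) \<bullet> b)))"
    by (simp add: laplacian_def)
  also have "\<dots> = real (2 * n) * (2 * deriv H ((norm (x - a))\<^sup>2)) +
      4 * deriv (deriv H) ((norm (x - a))\<^sup>2) * (norm (x - a))\<^sup>2"
    unfolding sum.distrib sum_distrib_left[symmetric] euclidean_inner[of "x - a" "x - a", symmetric]
      power2_norm_eq_inner by (simp add: dim)
  finally show ?thesis by (simp add: radial_op_def algebra_simps)
qed

lemma neg_laplacian_power_radial: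
  fixes a :: "'a::euclidean_space"
  assumes H: "smooth H" and dim: "DIM('a) = 2 * n"
  shows "neg_laplacian_power m (\<lambda>x. H ((norm (x - a))\<^sup>2)) =
    (\<lambda>x. (radial_op n ^^ m) H ((norm (x - a))\<^sup>2))"
  unfolding neg_laplacian_power_def
  by (induction m)
    (simp_all add: laplacian_radial[OF smooth_radial_op_funpow[OF H] dim])

text \<open>The right-hand side keeps the shape of the left one, with additive constant 0, so that
  the same equation rewrites the second derivative.\<close>

lemma deriv_scale_comb:
  assumes "smooth F" "smooth G"
  shows "deriv (\<lambda>t. a * F (p * t) + b * G (q * t) + c) =
    (\<lambda>t. a * p * deriv F (p * t) + b * q * deriv G (q * t) + 0)"
proof (rule ext, rule DERIV_imp_deriv)
  fix t
  have *: "((\<lambda>t. k * t) has_real_derivative k) (at t)" for k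
    by (auto intro!: derivative_eq_intros)
  show "((\<lambda>t. a * F (p * t) + b * G (q * t) + c) has_real_derivative
      a * p * deriv F (p * t) + b * q * deriv G (q * t) + 0) (at t)"
    by (rule DERIV_cong[OF DERIV_add[OF DERIV_add[OF
        DERIV_cmult[OF DERIV_chain2[OF smooth_deriv(1)[OF assms(1)] *]]
        DERIV_cmult[OF DERIV_chain2[OF smooth_deriv(1)[OF assms(2)] *]]] DERIV_const]])
      (simp add: algebra_simps)
qed

lemma radial_op_scale_comb:
  assumes "smooth F" "smooth G"
  shows "radial_op n (\<lambda>t. a * F (p * t) + b * G (q * t) + c) =
    (\<lambda>t. a * p * radial_op n F (p * t) + b * q * radial_op n G (q * t))"
  by (rule ext, unfold radial_op_def deriv_scale_comb[OF assms]
      deriv_scale_comb[OF smooth_deriv(2)[OF assms(1)] smooth_deriv(2)[OF assms(2)]])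
    (simp add: algebra_simps)

text \<open>Under the scaling t -> p t each application of \<open>radial_op\<close> yields one
  factor p, and the first application kills the constant.\<close>

lemma radial_op_funpow_scale_comb:
  assumes "smooth H"
  shows "(radial_op n ^^ m) (\<lambda>t. a * H (p * t) + b * H (q * t) + c) =
    (\<lambda>t. a * p ^ m * (radial_op n ^^ m) H (p * t) + b * q ^ m * (radial_op n ^^ m) H (q * t)
      + (if m = 0 then c else 0))"
proof (induction m)
  case (Suc m)
  note F = smooth_radial_op_funpow[OF assms, where n = n and m = m]
  have "(radial_op n ^^ Suc m) (\<lambda>t. a * H (p * t) + b * H (q * t) + c) =
      radial_op n (\<lambda>t. (a * p ^ m) * (radial_op n ^^ m) H (p * t) +
        (b * q ^ m) * (radial_op n ^^ m) H (q * t) + (if m = 0 then c else 0))"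
    by (simp only: funpow.simps(2) comp_apply Suc)
  also have "\<dots> = (\<lambda>t. a * p ^ m * p * radial_op n ((radial_op n ^^ m) H) (p * t) +
      b * q ^ m * q * radial_op n ((radial_op n ^^ m) H) (q * t))"
    by (rule radial_op_scale_comb[OF F F])
  finally show ?case by (simp add: mult.assoc mult.commute[of p] mult.commute[of q])
qed simp

text \<open>Beyond 1 \<open>smooth_ln\<close> is ln. If H' = c t^(-j-1) there, then
  \<open>radial_op n H\<close> is -4 (n - 1 - j) c t^(-j-1), whose derivative is a multiple of
  t^(-j-2); the product collects these factors. Tracking derivatives puts ln itself, the case j = 0,
  on the same footing as the powers.\<close>

lemma radial_op_funpow_smooth_ln:
  assumes "t > 1"
  shows "deriv ((radial_op n ^^ j) smooth_ln) t =
    (\<Prod>i<j. 4 * (real i + 1) * (real n - 1 - real i)) * inverse t ^ Suc j"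
    and "radial_op n ((radial_op n ^^ j) smooth_ln) t =
    - 4 * (real n - 1 - real j) * (\<Prod>i<j. 4 * (real i + 1) * (real n - 1 - real i)) * inverse t ^ Suc j"
proof -
  let ?b = "\<lambda>j. \<Prod>i<j. 4 * (real i + 1) * (real n - 1 - real i)"
  have near: "\<forall>\<^sub>F s in nhds t. 1 < s" if "t > 1" for t :: real
    using eventually_nhds_in_open[of "{1<..}" t] that by simp
  have pow: "((\<lambda>t. c * inverse t ^ Suc j) has_real_derivative
      - (real (Suc j) * c * inverse t ^ Suc (Suc j))) (at t)" if "t > 1" for c j and t :: real
    by (rule DERIV_cong[OF DERIV_cmult[OF DERIV_power[OF DERIV_inverse]]])
      (use that in \<open>simp_all add: algebra_simps\<close>)
  have radial: "radial_op n H t = - 4 * (real n - 1 - real j) * c * inverse t ^ Suc j"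
    if "t > 1" "\<And>t. t > 1 \<Longrightarrow> deriv H t = c * inverse t ^ Suc j" for H c j and t :: real
  proof -
    have "deriv (deriv H) t = deriv (\<lambda>t. c * inverse t ^ Suc j) t"
      by (rule deriv_cong_ev[OF eventually_mono[OF near[OF that(1)] that(2)] refl])
    also have "\<dots> = - (real (Suc j) * c * inverse t ^ Suc (Suc j))"
      by (rule DERIV_imp_deriv[OF pow[OF that(1)]])
    finally have dd: "deriv (deriv H) t = - (real (Suc j) * c * inverse t ^ Suc (Suc j))" .
    have "radial_op n H t =
        4 * real (Suc j) * c * (t * inverse t ^ Suc (Suc j)) - 4 * real n * (c * inverse t ^ Suc j)"
      unfolding radial_op_def that(2)[OF that(1)] dd by (simp add: algebra_simps)
    moreover have "t * inverse t ^ Suc (Suc j) = inverse t ^ Suc j"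
      using that(1) by simp
    ultimately show ?thesis
      by (simp add: algebra_simps del: power_Suc)
  qed
  have main: "deriv ((radial_op n ^^ j) smooth_ln) t = ?b j * inverse t ^ Suc j"
    if "t > 1" for j and t :: real
    using that
  proof (induction j arbitrary: t)
    case 0
    have "deriv smooth_ln t = deriv ln t"
      by (rule deriv_cong_ev[OF eventually_mono[OF near[OF 0]] refl]) (simp add: smooth_ln_eq)
    also have "\<dots> = inverse t"
      using 0 by (intro DERIV_imp_deriv) (auto intro!: derivative_eq_intros simp: divide_inverse)
    finally show ?case by simp
  next
    case (Suc j)
    have "deriv ((radial_op n ^^ Suc j) smooth_ln) t =
        deriv (\<lambda>t. (- 4 * (real n - 1 - real j) * ?b j) * inverse t ^ Suc j) t"
      by (rule deriv_cong_ev[OF eventually_mono[OF near[OF Suc.prems]] refl])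
        (simp only: funpow.simps(2) comp_apply, rule radial[OF _ Suc.IH])
    also have "\<dots> = - (real (Suc j) * (- 4 * (real n - 1 - real j) * ?b j) * inverse t ^ Suc (Suc j))"
      by (rule DERIV_imp_deriv[OF pow[OF Suc.prems]])
    finally show ?case by (simp add: algebra_simps)
  qed
  show "deriv ((radial_op n ^^ j) smooth_ln) t = ?b j * inverse t ^ Suc j"
    by (rule main[OF assms])
  show "radial_op n ((radial_op n ^^ j) smooth_ln) t =
      - 4 * (real n - 1 - real j) * ?b j * inverse t ^ Suc j"
    by (rule radial[OF assms main])
qed

section \<open>The kernel and its mass\<close>

text \<open>\<open>kernel n (|x|\<^sup>2)\<close> is \<open>(- \<Delta>)\<^sup>n\<close> applied to a smoothing of \<open>- ln |x|\<close>.\<close>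

definition kernel :: "nat \<Rightarrow> real \<Rightarrow> real" where
  "kernel n t = - (1 / 2) * (radial_op n ^^ n) smooth_ln t"

lemma continuous_on_kernel: "continuous_on UNIV (kernel n)"
  unfolding kernel_def[abs_def]
  by (intro continuous_intros smooth_continuous smooth_radial_op_funpow smooth_smooth_ln)

text \<open>At the last of the n applications the factor n - 1 - j is 0: ln |x| is polyharmonic away
  from the origin. The endpoint t = 1 follows by continuity.\<close>

lemma kernel_eq_0:
  assumes "n \<ge> 1" "t \<ge> 1"
  shows "kernel n t = 0"
proof -
  obtain m where m: "n = Suc m" using assms(1) by (cases n) auto
  have 0: "kernel n s = 0" if "s > 1" for s
    using radial_op_funpow_smooth_ln(2)[OF that, of n m] by (simp add: kernel_def m)
  have "(kernel n \<longlongrightarrow> kernel n 1) (at_right 1)"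
    using continuous_on_kernel[of n]
    by (simp add: continuous_on_eq_continuous_at isCont_def filterlim_at_split)
  moreover have "(kernel n \<longlongrightarrow> 0) (at_right 1)"
    by (rule tendsto_eventually) (auto simp: eventually_at_filter 0)
  ultimately have "kernel n 1 = 0"
    using tendsto_unique[OF trivial_limit_at_right_real] by blast
  with 0 assms(2) show ?thesis by (cases "t = 1") auto
qed

text \<open>A substitute for polar coordinates: the set where |x|^2 \<le> t is a ball of volume V
  t^n, whose derivative in t is the stated density. Half-lines are stable under intersection and
  generate the Borel sets.\<close>

lemma distr_norm_square:
  assumes "n \<ge> 1" and dim: "DIM('a::euclidean_space) = 2 * n"
  shows "distr lborel borel (\<lambda>x::'a. (norm x)\<^sup>2) =
    density lborel (\<lambda>t. ennreal (unit_ball_vol (2 * real n) * real n * t ^ (n - 1) * indicator {0..} t))"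
    (is "?M = ?N")
proof (rule measure_eqI_generator_eq[where E = "range (\<lambda>t::real. {..t})" and \<Omega> = UNIV
      and A = "\<lambda>i. {..real i}"])
  define V where "V = unit_ball_vol (2 * real n)"
  have V: "V \<ge> 0" by (simp add: V_def)
  have M: "emeasure ?M {..t} = ennreal (if t \<ge> 0 then V * t ^ n else 0)" for t
  proof -
    have "emeasure ?M {..t} = emeasure lborel {x::'a. (norm x)\<^sup>2 \<le> t}"
      by (subst emeasure_distr) (auto simp: vimage_def)
    also have "\<dots> = ennreal (if t \<ge> 0 then V * t ^ n else 0)"
    proof (cases "t \<ge> 0")
      case True
      then have "{x::'a. (norm x)\<^sup>2 \<le> t} = cball 0 (sqrt t)"
        by (auto simp: real_le_rsqrt sqrt_le_D real_sqrt_le_iff intro: real_le_rsqrt)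
          (metis norm_ge_zero power_mono real_sqrt_pow2)
      moreover have "sqrt t ^ (2 * n) = t ^ n"
        using True by (simp add: power_mult)
      ultimately show ?thesis
        using True by (simp add: emeasure_cball dim V_def)
    next
      case False
      then have "{x::'a. (norm x)\<^sup>2 \<le> t} = {}"
        by (auto simp: not_le intro: less_le_trans)
      with False show ?thesis by simp
    qed
    finally show ?thesis .
  qed
  have N: "emeasure ?N {..t} = ennreal (if t \<ge> 0 then V * t ^ n else 0)" for t
  proof -
    have "emeasure ?N {..t} =
        (\<integral>\<^sup>+s. ennreal (V * real n * s ^ (n - 1)) * indicator {0..t} s \<partial>lborel)"
      by (subst emeasure_density)
        (auto intro!: nn_integral_cong simp: V_def split: split_indicator)
    also have "\<dots> = ennreal (if t \<ge> 0 then V * t ^ n else 0)"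
    proof (cases "t \<ge> 0")
      case True
      have "(\<integral>\<^sup>+s. ennreal (V * real n * s ^ (n - 1)) * indicator {0..t} s \<partial>lborel) =
          ennreal (V * t ^ n - V * 0 ^ n)"
        by (rule nn_integral_FTC_Icc[OF _ _ _ True])
          (auto intro!: derivative_eq_intros mult_nonneg_nonneg V)
      with True assms(1) show ?thesis by (simp add: power_0_left)
    next
      case False
      then have "{0..t} = {}" by simp
      with False show ?thesis by simp
    qed
    finally show ?thesis .
  qed
  show "emeasure ?M X = emeasure ?N X" if "X \<in> range (\<lambda>t::real. {..t})" for X
    using that M N by auto
  show "Int_stable (range (\<lambda>t::real. {..t}))"
    by (auto simp: Int_stable_def)
  show "sets ?M = sigma_sets UNIV (range (\<lambda>t::real. {..t}))"
    by (simp add: borel_eq_atMost)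
  show "sets ?N = sigma_sets UNIV (range (\<lambda>t::real. {..t}))"
    by (simp add: borel_eq_atMost)
  show "(\<Union>i. {..real i}) = UNIV"
    by (auto simp: real_arch_simple)
  show "emeasure ?M {..real i} \<noteq> \<infinity>" for i
    by (simp add: M)
qed auto

text \<open>In the variable t = |x|^2 the integrand is V n t^(n-1) (2 t H'' + 2 n H'), the exact
  derivative of 2 V n t^n H'. Only the value of H' beyond the smoothing matters, where it is known
  explicitly.\<close>

lemma integral_kernel:
  assumes n: "n \<ge> 1" and dim: "DIM('a::euclidean_space) = 2 * n"
  shows "(LINT x::'a|lborel. kernel n ((norm x)\<^sup>2)) = gamma_const n"
proof -
  obtain m where m: "n = Suc m" using n by (cases n) auto
  then have m1: "n - Suc 0 = m" by simp
  define V where "V = unit_ball_vol (2 * real n)"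
  define b where "b = (\<Prod>i<m. 4 * (real i + 1) * (real n - 1 - real i))"
  define H where "H = (radial_op n ^^ m) smooth_ln"
  have H: "smooth H"
    unfolding H_def by (intro smooth_radial_op_funpow smooth_smooth_ln)
  note D = smooth_deriv(1)[OF smooth_deriv(2)[OF H]]
  have kernel: "kernel n t = 2 * t * deriv (deriv H) t + 2 * real n * deriv H t" for t
    by (simp add: kernel_def H_def m radial_op_def field_simps)
  have [measurable]: "kernel n \<in> borel_measurable borel"
    by (rule borel_measurable_continuous_onI[OF continuous_on_kernel])
  have "(LINT x::'a|lborel. kernel n ((norm x)\<^sup>2)) =
      integral\<^sup>L (distr lborel borel (\<lambda>x::'a. (norm x)\<^sup>2)) (kernel n)"
    by (rule integral_distr[symmetric]) auto
  also have "\<dots> = (LINT t|lborel. (V * real n * t ^ m * indicator {0..} t) *\<^sub>R kernel n t)"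
    unfolding distr_norm_square[OF n dim]
    by (subst integral_density) (auto simp: V_def m1 indicator_def)
  \<comment> \<open>The kernel vanishes from 1 on. The endpoint 2 leaves room, because the formula
    for \<open>deriv H\<close> holds only for t > 1.\<close>
  also have "\<dots> = (LINT t|lborel. (V * real n * t ^ m * kernel n t) * indicator {0..2} t)"
    by (rule Bochner_Integration.integral_cong)
      (auto simp: kernel_eq_0[OF n] split: split_indicator)
  also have "\<dots> = 2 * V * real n * (2 ^ n * deriv H 2) - 2 * V * real n * (0 ^ n * deriv H 0)"
  proof (rule integral_FTC_Icc_real)
    fix t :: real
    show "((\<lambda>t. 2 * V * real n * (t ^ n * deriv H t)) has_real_derivative
        V * real n * t ^ m * kernel n t) (at t)"
      by (rule DERIV_cong[OF DERIV_cmult[OF DERIV_mult[OF DERIV_pow D]]])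
        (simp only: kernel, simp add: m algebra_simps)
    show "isCont (\<lambda>t. V * real n * t ^ m * kernel n t) t"
      using continuous_on_kernel[of n]
      by (auto intro!: continuous_intros simp: continuous_on_eq_continuous_at)
  qed simp
  also have "deriv H 2 = b * inverse 2 ^ n"
    unfolding H_def b_def m by (rule radial_op_funpow_smooth_ln(1)) simp
  also have "2 * V * real n * (2 ^ n * (b * inverse 2 ^ n)) - 2 * V * real n * (0 ^ n * deriv H 0) =
      2 * V * real n * b"
    by (simp add: m power_inverse[symmetric] power_mult_distrib[symmetric] field_simps)
  also have "b = 4 ^ m * fact m * fact m"
  proof -
    have "(\<Prod>i<m. real i + 1) = fact m"
      by (induction m) (simp_all add: algebra_simps)
    \<comment> \<open>Reversing the index: n - 1 - i = m - i is the successor of m - 1 - i.\<close>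
    moreover have "(\<Prod>i<m. real n - 1 - real i) = (\<Prod>i<m. real i + 1)"
      by (rule prod.reindex_bij_witness[where i = "\<lambda>i. m - 1 - i" and j = "\<lambda>i. m - 1 - i"])
        (auto simp: m of_nat_diff)
    ultimately show ?thesis
      unfolding b_def prod.distrib by simp
  qed
  also have "V = pi ^ n / fact n"
    unfolding V_def using unit_ball_vol_even[of n] by simp
  also have "2 * (pi ^ n / fact n) * real n * (4 ^ m * fact m * fact m) =
      2 ^ (2 * n - 1) * fact (n - 1) * pi ^ n"
  proof -
    have "(2::real) ^ (2 * n - 1) = 2 * 4 ^ m" "fact n = real n * (fact m :: real)" "real n \<noteq> 0"
      using power_mult[of "2::real" 2 m] by (simp_all add: m)
    then show ?thesis by (simp add: m1)
  qed
  finally show ?thesis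
    unfolding gamma_const_closed_form[OF n] .
qed

section \<open>Truncated logarithms and averages\<close>

lemma integrable_continuous_compact_support:
  fixes f :: "'a::euclidean_space \<Rightarrow> real"
  assumes "continuous_on UNIV f" and "\<And>x. x \<notin> cball a r \<Longrightarrow> f x = 0"
  shows "integrable lborel f"
proof -
  have "integrable lborel (\<lambda>x. indicator (cball a r) x *\<^sub>R f x)"
    by (intro borel_integrable_compact continuous_on_subset[OF assms(1)]) auto
  also have "(\<lambda>x. indicator (cball a r) x *\<^sub>R f x) = f"
    using assms(2) by (auto simp: fun_eq_iff indicator_def)
  finally show ?thesis .
qed

lemma lborel_integral_affine:
  fixes f :: "'a::euclidean_space \<Rightarrow> real" and a :: 'a
  assumes [measurable]: "f \<in> borel_measurable borel" and "s > 0"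
  shows "(LINT y|lborel. f y) = s ^ DIM('a) * (LINT z|lborel. f (a + s *\<^sub>R z))"
proof -
  have "(LINT y|lborel. f y) =
      (LINT y|density (distr lborel borel (\<lambda>z::'a. a + s *\<^sub>R z)) (\<lambda>_. \<bar>s\<bar> ^ DIM('a)). f y)"
    using lborel_affine[of s a] assms(2) by simp
  also have "\<dots> = (LINT y|distr lborel borel (\<lambda>z::'a. a + s *\<^sub>R z). \<bar>s\<bar> ^ DIM('a) *\<^sub>R f y)"
    by (subst integral_density) auto
  also have "\<dots> = (LINT z|lborel. \<bar>s\<bar> ^ DIM('a) *\<^sub>R f (a + s *\<^sub>R z))"
    by (subst integral_distr) auto
  finally show ?thesis using assms(2) by simp
qed

lemma integrable_Fatou:
  fixes g :: "nat \<Rightarrow> 'a \<Rightarrow> real"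
  assumes [measurable]: "h \<in> borel_measurable M"
    and g: "\<And>k. integrable M (g k)" "\<And>k x. g k x \<ge> 0" "\<And>k. integral\<^sup>L M (g k) \<le> B"
    and lim: "\<And>x. (\<lambda>k. g k x) \<longlonglongrightarrow> h x"
  shows "integrable M h"
proof -
  have [measurable]: "g k \<in> borel_measurable M" for k
    using g(1) by (rule borel_measurable_integrable)
  have h: "h x \<ge> 0" for x
    by (rule LIMSEQ_le_const[OF lim]) (use g(2) in auto)
  have "(\<integral>\<^sup>+x. ennreal (h x) \<partial>M) = (\<integral>\<^sup>+x. liminf (\<lambda>k. ennreal (g k x)) \<partial>M)"
    by (intro nn_integral_cong lim_imp_Liminf[symmetric] tendsto_ennrealI lim) simp
  also have "\<dots> \<le> liminf (\<lambda>k. \<integral>\<^sup>+x. ennreal (g k x) \<partial>M)"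
    by (rule nn_integral_liminf) measurable
  also have "\<dots> \<le> limsup (\<lambda>k. \<integral>\<^sup>+x. ennreal (g k x) \<partial>M)"
    by (rule Liminf_le_Limsup) simp
  also have "\<dots> \<le> ennreal B"
    by (rule Limsup_bounded) (simp add: nn_integral_eq_integral[OF g(1)] g(2,3) ennreal_leI)
  finally have "(\<integral>\<^sup>+x. ennreal (h x) \<partial>M) < \<infinity>"
    by (simp add: le_less_trans)
  then show ?thesis
    using h by (intro integrableI_nonneg) auto
qed

text \<open>Dominated convergence is applied along sequences. The offset c keeps the norms away from
  small values; the choice c = 2 will keep ln |x| positive.\<close>

lemma tendsto_at_infinity_sequentiallyI:
  fixes F :: "'a::real_normed_vector \<Rightarrow> 'b::metric_space"
  assumes "\<And>X. (\<And>k. norm (X k) \<ge> real k + c) \<Longrightarrow> (\<lambda>k. F (X k)) \<longlonglongrightarrow> L"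
  shows "(F \<longlongrightarrow> L) at_infinity"
proof (rule ccontr)
  assume "\<not> (F \<longlongrightarrow> L) at_infinity"
  then obtain e where e: "e > 0" "\<not> (\<forall>\<^sub>F x in at_infinity. dist (F x) L < e)"
    by (auto simp: tendsto_iff)
  then have "\<forall>k. \<exists>x. norm x \<ge> real k + c \<and> dist (F x) L \<ge> e"
    unfolding eventually_at_infinity by (meson not_le)
  then obtain X where X: "\<And>k. norm (X k) \<ge> real k + c" "\<And>k. dist (F (X k)) L \<ge> e"
    by metis
  from assms[OF X(1)] e(1) have "\<forall>\<^sub>F k in sequentially. dist (F (X k)) L < e"
    by (simp add: tendsto_iff)
  then show False
    using X(2) eventually_happens by (auto simp: not_less[symmetric])
qed

text \<open>An error that stays bounded is negligible against ln r. With c = 0 this also disposes of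
  bounded terms.\<close>

lemma tendsto_divide_ln:
  fixes r v :: "nat \<Rightarrow> real"
  assumes r: "filterlim r at_top sequentially"
    and bound: "\<forall>\<^sub>F k in sequentially. \<bar>v k - c * ln (r k)\<bar> \<le> B"
  shows "(\<lambda>k. v k / ln (r k)) \<longlonglongrightarrow> c"
proof -
  have ln: "filterlim (\<lambda>k. ln (r k)) at_top sequentially"
    by (rule filterlim_compose[OF ln_at_top r])
  have pos: "\<forall>\<^sub>F k in sequentially. ln (r k) > 0"
    using ln by (rule filterlim_at_top_dense[THEN iffD1, rule_format])
  have "(\<lambda>k. v k / ln (r k) - c) \<longlonglongrightarrow> 0"
  proof (rule tendsto_rabs_zero_cancel, rule tendsto_sandwich[where f = "\<lambda>_. 0" and h = "\<lambda>k. B / ln (r k)"])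
    show "(\<lambda>k. B / ln (r k)) \<longlonglongrightarrow> 0"
      by (rule tendsto_divide_0[OF tendsto_const filterlim_at_top_imp_at_infinity[OF ln]])
    show "\<forall>\<^sub>F k in sequentially. \<bar>v k / ln (r k) - c\<bar> \<le> B / ln (r k)"
      using bound pos
    proof eventually_elim
      case (elim k)
      then have "v k / ln (r k) - c = (v k - c * ln (r k)) / ln (r k)"
        by (simp add: field_simps)
      with elim show ?case by (simp add: divide_right_mono)
    qed
  qed auto
  then show ?thesis by (rule LIM_zero_cancel)
qed

text \<open>A smooth version of \<open>y \<mapsto> ln (t / |y - x|)\<close>, constant near \<open>x\<close> at scale \<open>s\<close> and vanishing
  for \<open>|y - x| \<ge> t\<close>.\<close>

definition tlog :: "real \<Rightarrow> real \<Rightarrow> 'a::euclidean_space \<Rightarrow> 'a \<Rightarrow> real" where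
  "tlog s t x y = 1 / 2 * smooth_ln (1 / t\<^sup>2 * (norm (y - x))\<^sup>2)
    + - 1 / 2 * smooth_ln (1 / s\<^sup>2 * (norm (y - x))\<^sup>2) + ln (t / s)"

lemma half_smooth_ln_quotient:
  assumes "0 < s" "s \<le> r"
  shows "1 / 2 * smooth_ln (1 / s\<^sup>2 * r\<^sup>2) = ln r - ln s"
proof -
  have "1 / s\<^sup>2 * r\<^sup>2 = (r / s)\<^sup>2" by (simp add: power_divide)
  moreover have "(r / s)\<^sup>2 \<ge> 1"
    using assms by (intro one_le_power) simp
  moreover have "ln ((r / s)\<^sup>2) = 2 * (ln r - ln s)"
    using assms by (subst ln_realpow) (auto simp: ln_div)
  ultimately show ?thesis by (simp add: smooth_ln_eq)
qed

lemma tlog_eq_0: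
  assumes "0 < s" "0 < t" "norm (y - x) \<ge> s" "norm (y - x) \<ge> t"
  shows "tlog s t x y = 0"
  unfolding tlog_def using half_smooth_ln_quotient[OF assms(1,3)] half_smooth_ln_quotient[OF assms(2,4)] assms
  by (simp add: ln_div diff_divide_distrib)

lemma tlog_outer:
  assumes "0 < s" "0 < t" "norm (y - x) \<ge> s"
  shows "tlog s t x y = 1 / 2 * smooth_ln (1 / t\<^sup>2 * (norm (y - x))\<^sup>2) + ln t - ln (norm (y - x))"
  unfolding tlog_def using half_smooth_ln_quotient[OF assms(1,3)] assms
  by (simp add: ln_div diff_divide_distrib)

lemma scaled_norm_square_le_1:
  assumes "0 < t" "0 \<le> r" "r \<le> t"
  shows "1 / t\<^sup>2 * r\<^sup>2 \<in> {0..1::real}"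
  using assms by (simp add: power_mono)

text \<open>At distance at least s from the centre the inner logarithm is exact, and smoothing the
  outer one can only raise the value.\<close>

lemma tlog_nonneg:
  assumes "0 < s" "s \<le> t" "norm (y - x) \<ge> s"
  shows "tlog s t x y \<ge> 0"
proof (cases "norm (y - x) \<ge> t")
  case True
  with assms tlog_eq_0[of s t y x] show ?thesis by simp
next
  case False
  define r where "r = norm (y - x)"
  have pos: "r > 0" "t > 0" using assms by (auto simp: r_def)
  have "ln (1 / t\<^sup>2 * r\<^sup>2) \<le> smooth_ln (1 / t\<^sup>2 * r\<^sup>2)"
    using pos by (intro smooth_ln_ge) simp
  moreover have "ln (1 / t\<^sup>2 * r\<^sup>2) = 2 * ln r - 2 * ln t"
    using pos by (simp add: ln_div ln_realpow)
  ultimately show ?thesis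
    using tlog_outer[of s t y x] assms pos by (simp add: r_def)
qed

text \<open>Three zones: inside both scales there are two smoothed terms of size at most M / 2 each;
  between the scales only one, with ln r between ln s and ln t; outside both the function is
  0.\<close>

lemma abs_tlog_le:
  assumes M: "\<And>t. t \<in> {0..1} \<Longrightarrow> \<bar>smooth_ln t\<bar> \<le> M" and "0 < s" "s \<le> t"
  shows "\<bar>tlog s t x y\<bar> \<le> M + ln (t / s)"
proof -
  define r where "r = norm (y - x)"
  have r0: "r \<ge> 0" by (simp add: r_def)
  have ln: "ln (t / s) = ln t - ln s" "ln s \<le> ln t"
    using assms by (auto simp: ln_div)
  have M0: "M \<ge> 0" using M[of 0] by simp
  consider "r \<le> s" | "s \<le> r" "r \<le> t" | "t \<le> r" by linarith
  then show ?thesis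
  proof cases
    case 1
    then have "\<bar>smooth_ln (1 / t\<^sup>2 * r\<^sup>2)\<bar> \<le> M" "\<bar>smooth_ln (1 / s\<^sup>2 * r\<^sup>2)\<bar> \<le> M"
      using assms(2,3) r0 by (intro M scaled_norm_square_le_1; simp)+
    with ln show ?thesis unfolding tlog_def r_def[symmetric] by linarith
  next
    case 2
    then have "\<bar>smooth_ln (1 / t\<^sup>2 * r\<^sup>2)\<bar> \<le> M"
      using assms(2,3) 2 r0 by (intro M scaled_norm_square_le_1) simp_all
    moreover have "ln s \<le> ln r" "ln r \<le> ln t"
      using 2 assms(2,3) by simp_all
    ultimately show ?thesis
      using tlog_outer[of s t y x, folded r_def] 2 assms(2,3) M0 ln by linarith
  next
    case 3
    then show ?thesis using tlog_eq_0[of s t y x, folded r_def] assms(2,3) M0 ln by simp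
  qed
qed

lemma smooth_tlog_profile: "smooth (\<lambda>\<tau>. 1 / 2 * smooth_ln (1 / t\<^sup>2 * \<tau>) + - 1 / 2 * smooth_ln (1 / s\<^sup>2 * \<tau>) + c)"
  by (intro smooth_add smooth_mult smooth_const smooth_scale smooth_smooth_ln)

lemma test_function_tlog:
  assumes "0 < s" "0 < t"
  shows "test_function (tlog s t x)"
proof -
  have "C_k k (tlog s t x)" for k
    unfolding tlog_def[abs_def]
    by (rule C_k_radial[where H = "\<lambda>\<tau>. 1 / 2 * smooth_ln (1 / t\<^sup>2 * \<tau>) + - 1 / 2 * smooth_ln (1 / s\<^sup>2 * \<tau>) + ln (t / s)"])
      (use smooth_tlog_profile in \<open>simp only: smooth_def\<close>)
  moreover have "{y. tlog s t x y \<noteq> 0} \<subseteq> cball x (max s t)"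
    using tlog_eq_0[OF assms, where x = x] by (force simp: dist_norm norm_minus_commute)
  then have "compact (closure {y. tlog s t x y \<noteq> 0})"
    using bounded_subset[OF bounded_cball] compact_closure by blast
  ultimately show ?thesis by (simp add: test_function_def)
qed

lemma continuous_on_tlog: "continuous_on UNIV (tlog s t x)"
  unfolding tlog_def[abs_def]
  by (rule smooth_continuous[unfolded smooth_def, OF allI, OF C_k_radial[where H = "\<lambda>\<tau>. 1 / 2 * smooth_ln (1 / t\<^sup>2 * \<tau>) + - 1 / 2 * smooth_ln (1 / s\<^sup>2 * \<tau>) + ln (t / s)"]])
    (use smooth_tlog_profile in \<open>simp only: smooth_def\<close>)

text \<open>Rescaling by 1 / s^2 produces s^(-2n) after n applications, and the constant ln (t / s)
  disappears because n \<ge> 1.\<close>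

lemma neg_laplacian_power_tlog:
  fixes x :: "'a::euclidean_space"
  assumes n: "n \<ge> 1" and dim: "DIM('a) = 2 * n"
  shows "neg_laplacian_power n (tlog s t x) =
    (\<lambda>y. 1 / s ^ (2 * n) * kernel n (1 / s\<^sup>2 * (norm (y - x))\<^sup>2)
      - 1 / t ^ (2 * n) * kernel n (1 / t\<^sup>2 * (norm (y - x))\<^sup>2))"
  unfolding tlog_def[abs_def] neg_laplacian_power_radial[OF smooth_tlog_profile dim]
    radial_op_funpow_scale_comb[OF smooth_smooth_ln]
  using n by (simp add: fun_eq_iff kernel_def power_divide power_mult)

section \<open>Averages against the rescaled kernel\<close>

definition average :: "nat \<Rightarrow> ('a::euclidean_space \<Rightarrow> real) \<Rightarrow> real \<Rightarrow> 'a \<Rightarrow> real" where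
  "average n u s x = (LINT z|lborel. u (x + s *\<^sub>R z) * kernel n ((norm z)\<^sup>2))"

lemma kernel_norm_eq_0: "n \<ge> 1 \<Longrightarrow> z \<notin> cball a 1 \<Longrightarrow> kernel n ((norm (z - a))\<^sup>2) = 0"
  by (rule kernel_eq_0) (simp_all add: dist_norm norm_minus_commute)

lemma continuous_on_kernel_norm: "continuous_on S (\<lambda>z. kernel n ((norm (z - a))\<^sup>2))"
  by (rule continuous_on_compose2[OF continuous_on_kernel]) (auto intro!: continuous_intros)

lemma
  assumes n: "n \<ge> 1" and u: "continuous_on UNIV u"
  shows integrable_kernel_mult: "integrable lborel (\<lambda>z. u z * kernel n ((norm (z - a))\<^sup>2))"
    and integrable_abs_kernel: "integrable lborel (\<lambda>z. \<bar>kernel n ((norm (z - a))\<^sup>2)\<bar>)"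
  by (rule integrable_continuous_compact_support[where a = a and r = 1];
      auto intro!: continuous_intros continuous_on_kernel_norm u kernel_norm_eq_0[OF n])+

text \<open>The substitution y = x + s z has Jacobian s^(2n), which cancels the prefactor. The
  averages are not normalised: the total weight is \<open>gamma_const n\<close>.\<close>

lemma
  fixes u :: "'a::euclidean_space \<Rightarrow> real"
  assumes n: "n \<ge> 1" and dim: "DIM('a) = 2 * n" and u: "continuous_on UNIV u" and s: "s > 0"
  shows average_eq: "(LINT y|lborel. u y * (1 / s ^ (2 * n) * kernel n (1 / s\<^sup>2 * (norm (y - x))\<^sup>2))) =
      average n u s x"
    and integrable_average: "integrable lborel
      (\<lambda>y. u y * (1 / s ^ (2 * n) * kernel n (1 / s\<^sup>2 * (norm (y - x))\<^sup>2)))"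
proof -
  have cont: "continuous_on UNIV (\<lambda>y. u y * (1 / s ^ (2 * n) * kernel n (1 / s\<^sup>2 * (norm (y - x))\<^sup>2)))"
    by (intro continuous_intros u continuous_on_compose2[OF continuous_on_kernel]) auto
  show "(LINT y|lborel. u y * (1 / s ^ (2 * n) * kernel n (1 / s\<^sup>2 * (norm (y - x))\<^sup>2))) =
      average n u s x"
    using s by (subst lborel_integral_affine[OF borel_measurable_continuous_onI[OF cont] s, of x])
      (simp add: average_def dim power_mult_distrib)
  show "integrable lborel
      (\<lambda>y. u y * (1 / s ^ (2 * n) * kernel n (1 / s\<^sup>2 * (norm (y - x))\<^sup>2)))"
  proof (rule integrable_continuous_compact_support[OF cont])
    fix y assume "y \<notin> cball x s"
    then have "s / s \<le> norm (y - x) / s"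
      using s by (intro divide_right_mono) (auto simp: dist_norm norm_minus_commute)
    then have "1 \<le> (norm (y - x) / s)\<^sup>2"
      using s by (intro one_le_power) simp
    then have "kernel n (1 / s\<^sup>2 * (norm (y - x))\<^sup>2) = 0"
      by (intro kernel_eq_0[OF n]) (simp add: power_divide)
    then show "u y * (1 / s ^ (2 * n) * kernel n (1 / s\<^sup>2 * (norm (y - x))\<^sup>2)) = 0"
      by simp
  qed
qed

lemma continuous_bounded_on_cball:
  fixes g :: "'a::euclidean_space \<Rightarrow> real"
  assumes "continuous_on UNIV g"
  shows "\<exists>B>0. \<forall>x\<in>cball a r. \<bar>g x\<bar> \<le> B"
proof -
  have "compact (g ` cball a r)"
    by (intro compact_continuous_image continuous_on_subset[OF assms]) auto
  then have "bounded (g ` cball a r)"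
    by (rule compact_imp_bounded)
  then show ?thesis
    unfolding bounded_pos ball_simps real_norm_def .
qed

section \<open>Solutions of the equation\<close>

locale conformal_equation =
  fixes n :: nat and K u :: "'a::euclidean_space \<Rightarrow> real"
  assumes n: "n \<ge> 1" and dim: "DIM('a) = 2 * n"
    and K: "continuous_on UNIV K"
    and growth: "\<exists>C>0. \<exists>l\<ge>0. \<forall>x. \<bar>K x\<bar> \<le> C * (norm x powr l + 1)"
    and solution: "conformal_solution n K u"
    and log_growth: "u \<in> O[at_infinity](\<lambda>x. ln (norm x))"
begin

lemma continuous_u: "continuous_on UNIV u"
  using solution by (simp add: conformal_solution_def)

definition f :: "'a \<Rightarrow> real" where "f y = K y * exp (2 * real n * u y)"

lemma continuous_f: "continuous_on UNIV f"
  unfolding f_def[abs_def] by (intro continuous_intros K continuous_u)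

lemma borel_measurable_u [measurable]: "u \<in> borel_measurable borel"
  and borel_measurable_f [measurable]: "f \<in> borel_measurable borel"
  and borel_measurable_kernel [measurable]: "kernel n \<in> borel_measurable borel"
  and borel_measurable_tlog [measurable]: "tlog s t x \<in> borel_measurable borel"
  by (rule borel_measurable_continuous_onI[OF continuous_u] borel_measurable_continuous_onI[OF continuous_f]
      borel_measurable_continuous_onI[OF continuous_on_kernel]
      borel_measurable_continuous_onI[OF continuous_on_tlog])+

text \<open>The shift by 2 keeps the logarithm at least ln 2, so a single constant also covers the
  ball where only continuity of \<open>u\<close> is available.\<close>

lemma u_bound: "\<exists>C>0. \<forall>y. \<bar>u y\<bar> \<le> C * ln (norm y + 2)"
proof -
  obtain c where c: "c > 0" "\<forall>\<^sub>F x in at_infinity. norm (u x) \<le> c * norm (ln (norm x))"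
    by (rule landau_o.bigE[OF log_growth]) (rule that)
  then obtain b where b: "\<And>x. norm x \<ge> b \<Longrightarrow> norm (u x) \<le> c * norm (ln (norm x))"
    unfolding eventually_at_infinity by blast
  obtain B where B: "B > 0" "\<And>x. norm x \<le> max b 1 \<Longrightarrow> \<bar>u x\<bar> \<le> B"
    using continuous_bounded_on_cball[OF continuous_u, of 0 "max b 1"] by (metis mem_cball_0)
  have "\<bar>u y\<bar> \<le> (c + B / ln 2) * ln (norm y + 2)" for y
  proof (cases "norm y \<le> max b 1")
    case True
    have "B = B / ln 2 * ln 2" by simp
    also have "\<dots> \<le> B / ln 2 * ln (norm y + 2)"
      using B(1) by (intro mult_left_mono ln_mono) auto
    also have "\<dots> \<le> (c + B / ln 2) * ln (norm y + 2)"
      using c(1) by (intro mult_right_mono) auto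
    finally show ?thesis using B(2)[OF True] by linarith
  next
    case False
    then have y: "norm y > 1" "norm y \<ge> b" by auto
    have "\<bar>u y\<bar> \<le> c * ln (norm y)" using b[OF y(2)] y(1) by (simp del: zero_less_norm_iff)
    also have "\<dots> \<le> (c + B / ln 2) * ln (norm y + 2)"
      using y(1) c(1) B(1) by (intro mult_mono ln_mono) (auto simp del: zero_less_norm_iff)
    finally show ?thesis .
  qed
  moreover have "c + B / ln 2 > 0" using c(1) B(1) by (intro add_pos_pos) auto
  ultimately show ?thesis by blast
qed

text \<open>A logarithmic bound on \<open>u\<close> turns exp (2 n u) into a power of |y| + 2, which
  combines with the growth of \<open>K\<close>; the exponent is rounded up to a natural
  number.\<close>

lemma f_bound: "\<exists>B>0. \<exists>q\<ge>1. \<forall>y. \<bar>f y\<bar> \<le> B * (norm y + 2) ^ q"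
proof -
  obtain C l where C: "C > 0" "l \<ge> 0" "\<And>x. \<bar>K x\<bar> \<le> C * (norm x powr l + 1)"
    using growth by blast
  obtain c where c: "c > 0" "\<And>y. \<bar>u y\<bar> \<le> c * ln (norm y + 2)"
    using u_bound by blast
  define q where "q = nat \<lceil>l + 2 * real n * c\<rceil> + 1"
  have q: "l + 2 * real n * c \<le> real q"
    unfolding q_def by linarith
  have "\<bar>f y\<bar> \<le> (2 * C) * (norm y + 2) ^ q" for y
  proof -
    define m where "m = norm y + 2"
    have m: "m \<ge> 2" by (simp add: m_def)
    have "norm y powr l + 1 \<le> m powr l + m powr l"
      using C(2) m by (intro add_mono powr_mono2 ge_one_powr_ge_zero) (auto simp: m_def)
    then have "C * (norm y powr l + 1) \<le> C * (m powr l + m powr l)"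
      using C(1) by (intro mult_left_mono) auto
    with C(3)[of y] have Kb: "\<bar>K y\<bar> \<le> 2 * C * m powr l" by (simp add: algebra_simps)
    have "2 * real n * u y \<le> 2 * real n * (c * ln m)"
      using c(2)[of y] by (intro mult_left_mono) (auto simp: m_def)
    then have "exp (2 * real n * u y) \<le> m powr (2 * real n * c)"
      using m by (simp add: powr_def mult_ac)
    with Kb have "\<bar>K y\<bar> * exp (2 * real n * u y) \<le> (2 * C * m powr l) * m powr (2 * real n * c)"
      using C(1) by (intro mult_mono) auto
    also have "\<dots> = 2 * C * m powr (l + 2 * real n * c)"
      by (simp add: powr_add)
    also have "\<dots> \<le> 2 * C * m powr real q"
      using C(1) m q by (intro mult_left_mono powr_mono) auto
    also have "m powr real q = m ^ q"
      using m by (intro powr_realpow) auto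
    finally show ?thesis by (simp add: f_def abs_mult m_def)
  qed
  moreover have "2 * C > 0" "q \<ge> 1" using C(1) by (auto simp: q_def)
  ultimately show ?thesis by blast
qed

text \<open>This is the equation tested with \<open>tlog s t x\<close>; the distributional identity
  enters the argument only here.\<close>

lemma average_diff:
  assumes "s > 0" "t > 0"
  shows "average n u s x - average n u t x = (LINT y|lborel. f y * tlog s t x y)"
proof -
  note avg = average_eq[OF n dim continuous_u, of _ x] and int = integrable_average[OF n dim continuous_u, of _ x]
  have "(LINT y|lborel. f y * tlog s t x y) =
      (LINT y|lborel. u y * neg_laplacian_power n (tlog s t x) y)"
    unfolding f_def
    by (rule solution[unfolded conformal_solution_def, THEN conjunct2, rule_format,
          OF test_function_tlog[OF assms], symmetric])
  also have "\<dots> = average n u s x - average n u t x"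
    unfolding neg_laplacian_power_tlog[OF n dim] right_diff_distrib avg[OF assms(1), symmetric]
      avg[OF assms(2), symmetric]
    by (rule Bochner_Integration.integral_diff[OF int[OF assms(1)] int[OF assms(2)]])
  finally show ?thesis ..
qed

lemma integrable_f_tlog:
  assumes "s > 0" "t > 0"
  shows "integrable lborel (\<lambda>y. f y * tlog s t x y)"
proof (rule integrable_continuous_compact_support[where a = x and r = "max s t"])
  show "f y * tlog s t x y = 0" if "y \<notin> cball x (max s t)" for y
    using that tlog_eq_0[OF assms, of y x] by (auto simp: dist_norm norm_minus_commute)
qed (intro continuous_intros continuous_f continuous_on_tlog)

text \<open>The rescaled kernels have mass \<open>gamma_const n\<close> and shrink to x. Since s k
  \<le> 1 and the kernel lives in the unit ball, only values of \<open>u\<close> on the unit ball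
  around x occur, which gives the dominating function.\<close>

lemma average_tendsto:
  assumes s: "s \<longlonglongrightarrow> 0" "\<And>k. 0 < s k" "\<And>k. s k \<le> 1"
  shows "(\<lambda>k. average n u (s k) x) \<longlonglongrightarrow> gamma_const n * u x"
proof -
  obtain B where B: "\<And>y. y \<in> cball x 1 \<Longrightarrow> \<bar>u y\<bar> \<le> B"
    using continuous_bounded_on_cball[OF continuous_u] by blast
  have "(\<lambda>k. LINT z|lborel. u (x + s k *\<^sub>R z) * kernel n ((norm z)\<^sup>2)) \<longlonglongrightarrow>
      (LINT z|lborel. u x * kernel n ((norm (z::'a))\<^sup>2))"
  proof (rule integral_dominated_convergence[where w = "\<lambda>z::'a. B * \<bar>kernel n ((norm z)\<^sup>2)\<bar>"])
    show "integrable lborel (\<lambda>z::'a. B * \<bar>kernel n ((norm z)\<^sup>2)\<bar>)"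
      using integrable_abs_kernel[OF n continuous_u, of 0] by simp
    show "AE z in lborel. (\<lambda>k. u (x + s k *\<^sub>R z) * kernel n ((norm z)\<^sup>2)) \<longlonglongrightarrow>
        u x * kernel n ((norm z)\<^sup>2)"
    proof (intro AE_I2 tendsto_intros)
      fix z :: 'a
      have "(\<lambda>k. x + s k *\<^sub>R z) \<longlonglongrightarrow> x + 0 *\<^sub>R z"
        by (intro tendsto_intros s(1))
      then show "(\<lambda>k. u (x + s k *\<^sub>R z)) \<longlonglongrightarrow> u x"
        using continuous_u by (intro isCont_tendsto_compose[of x u]) (auto simp: continuous_on_eq_continuous_at)
    qed
    show "AE z in lborel. norm (u (x + s k *\<^sub>R z) * kernel n ((norm z)\<^sup>2)) \<le>
        B * \<bar>kernel n ((norm z)\<^sup>2)\<bar>" for k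
    proof (rule AE_I2)
      fix z :: 'a
      show "norm (u (x + s k *\<^sub>R z) * kernel n ((norm z)\<^sup>2)) \<le> B * \<bar>kernel n ((norm z)\<^sup>2)\<bar>"
      proof (cases "norm z \<le> 1")
        case True
        then have "s k * norm z \<le> 1"
          using s(2)[of k] s(3)[of k] by (intro mult_le_one) auto
        then have "\<bar>u (x + s k *\<^sub>R z)\<bar> \<le> B"
          using s(2)[of k] by (intro B) (simp add: dist_norm)
        then show ?thesis by (simp add: abs_mult mult_right_mono)
      next
        case False
        then show ?thesis using kernel_norm_eq_0[OF n, of z 0] by simp
      qed
    qed
  qed (auto intro!: borel_measurable_times)
  then show ?thesis
    by (simp add: average_def integral_kernel[OF n dim] mult.commute)
qed

end

section \<open>Truncated logarithms divided by ln r\<close>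

lemma abs_tlog_div_ln_le:
  assumes M: "\<And>t. t \<in> {0..1} \<Longrightarrow> \<bar>smooth_ln t\<bar> \<le> M" and r: "r \<ge> 2"
    and s: "1 / (r + 3) ^ q \<le> s" "s \<le> 1"
  shows "\<bar>tlog s (r\<^sup>2) x y / ln r\<bar> \<le> M / ln 2 + 2 + 3 * real q"
proof -
  have s0: "s > 0"
    using s(1) r by (intro less_le_trans[OF _ s(1)]) auto
  have r2: "r\<^sup>2 \<ge> 1" using r by (intro one_le_power) auto
  have ln: "ln 2 \<le> ln r" "0 < ln r" using r by auto
  have M0: "M \<ge> 0" using M[of 0] by simp
  \<comment> \<open>For r \<ge> 2 one has r + 3 \<le> 4 r \<le> r^3. Hence -ln s \<le> 3 q ln r, the
    origin of the 3 q in the bound.\<close>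
  have "r + 3 \<le> r * 4" using r by simp
  also have "\<dots> \<le> r * r\<^sup>2"
    using r power_mono[of 2 r 2] by (intro mult_left_mono) auto
  finally have "ln (r + 3) \<le> ln (r ^ 3)"
    using r by (intro ln_mono) (auto simp: power3_eq_cube power2_eq_square)
  also have "\<dots> = 3 * ln r" using r by (subst ln_realpow) auto
  finally have ln3: "real q * ln (r + 3) \<le> real q * (3 * ln r)"
    by (intro mult_left_mono) auto
  have "ln (1 / (r + 3) ^ q) \<le> ln s"
    using s0 s(1) r by (intro ln_mono) auto
  moreover have "ln (1 / (r + 3) ^ q) = - (real q * ln (r + 3))"
    using r by (simp add: ln_div ln_realpow)
  moreover have "ln (r\<^sup>2 / s) = 2 * ln r - ln s"
    using r s0 by (simp add: ln_div ln_realpow)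
  ultimately have "ln (r\<^sup>2 / s) \<le> (2 + 3 * real q) * ln r"
    using ln3 by (simp add: algebra_simps)
  moreover have "M = M / ln 2 * ln 2" by simp
  moreover have "M / ln 2 * ln 2 \<le> M / ln 2 * ln r"
    using M0 ln by (intro mult_left_mono) auto
  moreover have "\<bar>tlog s (r\<^sup>2) x y\<bar> \<le> M + ln (r\<^sup>2 / s)"
    using s r2 s0 by (intro abs_tlog_le[OF M]) auto
  ultimately have "\<bar>tlog s (r\<^sup>2) x y\<bar> \<le> (M / ln 2 + 2 + 3 * real q) * ln r"
    by (simp add: algebra_simps)
  then show ?thesis
    using ln by (simp add: abs_divide divide_le_eq)
qed

text \<open>For fixed y the smoothing terms stay bounded, so only ln (r^2) = 2 ln r
  survives.\<close>

lemma tlog_centred_limit: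
  fixes y :: "'a::euclidean_space"
  assumes r: "\<And>k. r k \<ge> real k + 2"
  shows "(\<lambda>k. tlog 1 ((r k)\<^sup>2) 0 y / ln (r k)) \<longlonglongrightarrow> 2"
proof -
  obtain M where M: "\<And>t. t \<in> {0..1} \<Longrightarrow> \<bar>smooth_ln t\<bar> \<le> M"
    using smooth_ln_bounded by blast
  have top: "filterlim r at_top sequentially"
    by (rule filterlim_at_top_mono[OF filterlim_real_sequentially])
      (use r in \<open>auto intro!: always_eventually order_trans[OF _ r]\<close>)
  show ?thesis
  proof (rule tendsto_divide_ln[OF top])
    have "\<forall>\<^sub>F k in sequentially. r k \<ge> norm y"
      using top by (simp add: filterlim_at_top)
    then show "\<forall>\<^sub>F k in sequentially. \<bar>tlog 1 ((r k)\<^sup>2) 0 y - 2 * ln (r k)\<bar> \<le>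
        M + \<bar>smooth_ln ((norm y)\<^sup>2)\<bar>"
    proof eventually_elim
      case (elim k)
      have rk: "r k \<ge> 2" using r[of k] by linarith
      then have "r k * 1 \<le> r k * r k" by (intro mult_left_mono) auto
      with elim have "norm y \<le> (r k)\<^sup>2" by (simp add: power2_eq_square)
      then have "\<bar>smooth_ln (1 / ((r k)\<^sup>2)\<^sup>2 * (norm y)\<^sup>2)\<bar> \<le> M"
        using rk by (intro M scaled_norm_square_le_1) auto
      moreover have "ln ((r k)\<^sup>2) = 2 * ln (r k)"
        using rk by (simp add: ln_realpow)
      ultimately show ?case
        unfolding tlog_def by (simp add: abs_if split: if_splits)
    qed
  qed
qed

text \<open>For fixed y the distance |y - X k| eventually lies between r / 2 and 2 r, so ln (r^2 /
  |y - X k|) is ln r up to ln 2. The distance is also at least 1 \<ge> s k, so the inner logarithm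
  is exact.\<close>

lemma tlog_moving_limit:
  fixes X :: "nat \<Rightarrow> 'a::euclidean_space"
  assumes X: "\<And>k. norm (X k) \<ge> real k + 2" and s: "\<And>k. 0 < s k" "\<And>k. s k \<le> 1"
  shows "(\<lambda>k. tlog (s k) ((norm (X k))\<^sup>2) (X k) y / ln (norm (X k))) \<longlonglongrightarrow> 1"
proof -
  obtain M where M: "\<And>t. t \<in> {0..1} \<Longrightarrow> \<bar>smooth_ln t\<bar> \<le> M"
    using smooth_ln_bounded by blast
  have top: "filterlim (\<lambda>k. norm (X k)) at_top sequentially"
    by (rule filterlim_at_top_mono[OF filterlim_real_sequentially])
      (auto intro!: always_eventually order_trans[OF _ X])
  show ?thesis
  proof (rule tendsto_divide_ln[OF top])
    have "\<forall>\<^sub>F k in sequentially. norm (X k) \<ge> 2 * norm y + 2"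
      using top by (simp add: filterlim_at_top)
    then show "\<forall>\<^sub>F k in sequentially. \<bar>tlog (s k) ((norm (X k))\<^sup>2) (X k) y - 1 * ln (norm (X k))\<bar> \<le>
        M + ln 2"
    proof eventually_elim
      case (elim k)
      define r d where "r = norm (X k)" and "d = norm (y - X k)"
      have r: "r \<ge> 2" "r \<ge> 2 * norm y + 2" using elim X[of k] by (auto simp: r_def)
      have "r \<le> norm y + d"
        using norm_triangle_ineq4[of y "y - X k"] by (simp add: r_def d_def)
      with r have d1: "d \<ge> r / 2" "d \<ge> 1" by auto
      have "d \<le> norm y + r"
        unfolding d_def r_def by (rule norm_triangle_ineq4)
      with r have d2: "d \<le> 2 * r" by auto
      have "2 * r \<le> r * r" using r by (intro mult_right_mono) auto
      with d2 have d3: "d \<le> r\<^sup>2" by (simp add: power2_eq_square)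
      have "tlog (s k) (r\<^sup>2) (X k) y = 1 / 2 * smooth_ln (1 / (r\<^sup>2)\<^sup>2 * d\<^sup>2) + ln (r\<^sup>2) - ln d"
        unfolding d_def using s[of k] d1(2) r(1) by (intro tlog_outer) (auto simp: d_def)
      moreover have "\<bar>smooth_ln (1 / (r\<^sup>2)\<^sup>2 * d\<^sup>2)\<bar> \<le> M"
        using r d1 d3 by (intro M scaled_norm_square_le_1) auto
      moreover have "ln (r\<^sup>2) = 2 * ln r"
        using r by (simp add: ln_realpow)
      moreover have "ln r - ln 2 \<le> ln d"
        using r d1 ln_mono[of "r / 2" d] by (simp add: ln_div)
      moreover have "ln d \<le> ln 2 + ln r"
        using r d1 d2 ln_mono[of d "2 * r"] by (simp add: ln_mult)
      ultimately show ?case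
        unfolding r_def[symmetric] by linarith
    qed
  qed
qed

section \<open>Comparing averages at different scales and centres\<close>

context conformal_equation
begin

text \<open>Summing \<open>average_diff\<close> over the scales \<open>s / 2\<^sup>j\<close> avoids integrating against a singular
  logarithm: on a ball of radius \<open>s \<le> 1\<close> the density is at most polynomial in \<open>|x|\<close>, and the
  choice \<open>s = 1 / (|x| + 3)\<^sup>q\<close> absorbs this growth.\<close>

lemma average_near: "\<exists>D. \<exists>q\<ge>1. \<forall>x.
  \<bar>gamma_const n * u x - average n u (1 / (norm x + 3) ^ q) x\<bar> \<le> D"
proof -
  obtain B q where B: "B > 0" and q: "q \<ge> 1" and f_le: "\<And>y. \<bar>f y\<bar> \<le> B * (norm y + 2) ^ q"
    using f_bound by blast
  obtain M where M: "\<And>t. t \<in> {0..1} \<Longrightarrow> \<bar>smooth_ln t\<bar> \<le> M"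
    using smooth_ln_bounded by blast
  have M0: "M \<ge> 0" using M[of 0] by simp
  define D where "D = B * (M + ln 2) * unit_ball_vol (2 * real n)"
  have D: "D \<ge> 0" using B M0 by (simp add: D_def)
  have "\<bar>gamma_const n * u x - average n u (1 / (norm x + 3) ^ q) x\<bar> \<le> 2 * D" for x
  proof -
    define R where "R = (norm x + 3) ^ q"
    define s where "s = 1 / R"
    have R: "R \<ge> 1" unfolding R_def by (intro one_le_power) simp
    then have s: "0 < s" "s \<le> 1" by (simp_all add: s_def)
    \<comment> \<open>On a ball of radius at most 1 around x one has |y| + 2 \<le> |x| + 3, so the
      density is at most B R. Adjacent scales differ by a factor 2, hence M + ln 2, and the volume
      of the ball supplies \<sigma>^(2n).\<close>
    have step: "\<bar>average n u (\<sigma> / 2) x - average n u \<sigma> x\<bar> \<le> D * R * \<sigma> ^ (2 * n)"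
      if \<sigma>: "0 < \<sigma>" "\<sigma> \<le> 1" for \<sigma>
    proof -
      define c where "c = B * R * (M + ln 2)"
      have le: "\<bar>f y * tlog (\<sigma> / 2) \<sigma> x y\<bar> \<le> indicator (cball x \<sigma>) y * c" for y
      proof (cases "y \<in> cball x \<sigma>")
        case True
        then have "norm y + 2 \<le> norm x + 3"
          using norm_triangle_ineq2[of y x] \<sigma> by (simp add: dist_norm norm_minus_commute)
        then have "B * (norm y + 2) ^ q \<le> B * R"
          unfolding R_def using B by (intro mult_left_mono power_mono) auto
        then have "\<bar>f y\<bar> \<le> B * R" using f_le[of y] by linarith
        moreover have "\<bar>tlog (\<sigma> / 2) \<sigma> x y\<bar> \<le> M + ln 2"
          using abs_tlog_le[OF M, of "\<sigma> / 2" \<sigma> x y] \<sigma> by simp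
        ultimately have "\<bar>f y\<bar> * \<bar>tlog (\<sigma> / 2) \<sigma> x y\<bar> \<le> (B * R) * (M + ln 2)"
          using B R by (intro mult_mono) auto
        with True show ?thesis by (simp add: c_def abs_mult)
      next
        case False
        then have "tlog (\<sigma> / 2) \<sigma> x y = 0"
          using \<sigma> by (intro tlog_eq_0) (auto simp: dist_norm norm_minus_commute)
        with False show ?thesis by simp
      qed
      have fin: "emeasure lborel (cball x \<sigma>) < \<infinity>"
        using emeasure_bounded_finite[OF bounded_cball] by simp
      have "\<bar>average n u (\<sigma> / 2) x - average n u \<sigma> x\<bar> = \<bar>LINT y|lborel. f y * tlog (\<sigma> / 2) \<sigma> x y\<bar>"
        using \<sigma> by (subst average_diff) auto
      also have "\<dots> \<le> (LINT y|lborel. \<bar>f y * tlog (\<sigma> / 2) \<sigma> x y\<bar>)"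
        by (rule integral_abs_bound)
      also have "\<dots> \<le> (LINT y|lborel. indicator (cball x \<sigma>) y * c)"
        using \<sigma> fin by (intro integral_mono integrable_abs integrable_f_tlog le) auto
      also have "\<dots> = unit_ball_vol (2 * real n) * \<sigma> ^ (2 * n) * c"
        using \<sigma> by (simp add: content_cball dim)
      finally show ?thesis by (simp add: c_def D_def mult_ac)
    qed
    \<comment> \<open>The first j terms of 1 + 1/2 + 1/4 + ... add up to 2 - 2 / 2^j.\<close>
    have dyadic: "\<bar>average n u (s / 2 ^ j) x - average n u s x\<bar> \<le> D * (2 - 2 / 2 ^ j)" for j
    proof (induction j)
      case (Suc j)
      let ?\<sigma> = "s / 2 ^ j"
      have "s \<le> 2 ^ j" using s(2) one_le_power[of "2::real" j] by linarith
      then have \<sigma>: "0 < ?\<sigma>" "?\<sigma> \<le> 1" using s(1) by simp_all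
      \<comment> \<open>One power of the scale suffices: R times s / 2^j is 1 / 2^j because s = 1 /
        R.\<close>
      have "?\<sigma> ^ (2 * n) \<le> ?\<sigma> ^ 1"
        using \<sigma> n by (intro power_decreasing) auto
      then have "D * R * ?\<sigma> ^ (2 * n) \<le> D * R * ?\<sigma>"
        using D R by (intro mult_left_mono) auto
      also have "\<dots> = D * (1 / 2 ^ j)"
        using R by (simp add: s_def)
      finally have "\<bar>average n u (?\<sigma> / 2) x - average n u ?\<sigma> x\<bar> \<le> D * (1 / 2 ^ j)"
        using step[OF \<sigma>] by linarith
      moreover have "D * (2 - 2 / 2 ^ j) + D * (1 / 2 ^ j) = D * (2 - 2 / 2 ^ Suc j)"
        by (simp add: algebra_simps)
      moreover have e: "s / 2 ^ Suc j = ?\<sigma> / 2" by simp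
      ultimately show ?case unfolding e using Suc.IH by linarith
    qed simp
    have "(\<lambda>j. s * inverse (2 ^ j)) \<longlonglongrightarrow> 0"
      by (intro tendsto_mult_right_zero LIMSEQ_inverse_realpow_zero) simp
    then have lim: "(\<lambda>j. average n u (s / 2 ^ j) x) \<longlonglongrightarrow> gamma_const n * u x"
      using s one_le_power[of "2::real"]
      by (intro average_tendsto) (auto simp: divide_inverse[symmetric] intro: order_trans[OF s(2)])
    have "\<bar>gamma_const n * u x - average n u s x\<bar> \<le> 2 * D"
    proof (rule LIMSEQ_le_const2[OF tendsto_rabs[OF tendsto_diff[OF lim tendsto_const]]])
      have "D * (2 - 2 / 2 ^ j) \<le> 2 * D" for j
        using D by (simp add: algebra_simps)
      then show "\<exists>N. \<forall>j\<ge>N. \<bar>average n u (s / 2 ^ j) x - average n u s x\<bar> \<le> 2 * D"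
        using dyadic order_trans by blast
    qed
    then show ?thesis by (simp add: s_def R_def)
  qed
  with q show ?thesis by blast
qed

text \<open>The ball contains r^2 w for all |w| \<le> 2, the points met when averaging at scale r^2
  around a centre at distance r.\<close>

lemma u_log_bound: "\<exists>C>0. \<forall>r\<ge>2. \<forall>y. norm y \<le> 2 * r\<^sup>2 + r \<longrightarrow> \<bar>u y\<bar> \<le> C * ln r"
proof -
  obtain C where C: "C > 0" "\<And>y. \<bar>u y\<bar> \<le> C * ln (norm y + 2)"
    using u_bound by blast
  have "\<bar>u y\<bar> \<le> (4 * C) * ln r" if r: "r \<ge> 2" and y: "norm y \<le> 2 * r\<^sup>2 + r" for r y
  proof -
    have "2 * r \<le> r * r" using r by (intro mult_right_mono) auto
    with r y have "norm y + 2 \<le> 4 * r\<^sup>2" unfolding power2_eq_square by linarith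
    also have "\<dots> \<le> r\<^sup>2 * r\<^sup>2"
      using r power_mono[of 2 r 2] by (intro mult_right_mono) auto
    also have "\<dots> = r ^ 4" by (simp add: power_numeral_reduce)
    finally have "ln (norm y + 2) \<le> ln (r ^ 4)"
      by (intro ln_mono) (auto simp: add_nonneg_pos)
    also have "\<dots> = 4 * ln r" using r by (subst ln_realpow) auto
    finally have "C * ln (norm y + 2) \<le> C * (4 * ln r)"
      using C(1) by (intro mult_left_mono) auto
    with C(2)[of y] show ?thesis by simp
  qed
  moreover have "4 * C > 0" using C(1) by simp
  ultimately show ?thesis by blast
qed

text \<open>The average sees only |y| \<le> r^2, where \<open>u\<close> is O(ln r). This supplies
  the uniform bound that Fatou's lemma needs.\<close>

lemma average_centred_bound: "\<exists>C. \<forall>r\<ge>2. \<bar>average n u (r\<^sup>2) 0\<bar> \<le> C * ln r"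
proof -
  obtain C where C: "C > 0" "\<And>r y. r \<ge> 2 \<Longrightarrow> norm y \<le> 2 * r\<^sup>2 + r \<Longrightarrow> \<bar>u y\<bar> \<le> C * ln r"
    using u_log_bound by blast
  have "\<bar>average n u (r\<^sup>2) 0\<bar> \<le> (C * (LINT z::'a|lborel. \<bar>kernel n ((norm z)\<^sup>2)\<bar>)) * ln r"
    if r: "r \<ge> 2" for r
  proof -
    have "continuous_on UNIV (\<lambda>z. u (0 + r\<^sup>2 *\<^sub>R z))"
      by (intro continuous_on_compose2[OF continuous_u] continuous_intros) auto
    note int = integrable_kernel_mult[OF n this, of 0, simplified]
    have le: "\<bar>u (r\<^sup>2 *\<^sub>R z) * kernel n ((norm z)\<^sup>2)\<bar> \<le> C * ln r * \<bar>kernel n ((norm z)\<^sup>2)\<bar>" for z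
    proof (cases "norm z \<le> 1")
      case True
      then have "r\<^sup>2 * norm z \<le> r\<^sup>2 * 1" by (intro mult_left_mono) auto
      also have "r\<^sup>2 * 1 \<le> 2 * r\<^sup>2 + r" using r by (simp add: add_nonneg_pos add_increasing2)
      finally have "\<bar>u (r\<^sup>2 *\<^sub>R z)\<bar> \<le> C * ln r"
        using r by (intro C(2)) auto
      then show ?thesis by (simp add: abs_mult mult_right_mono)
    next
      case False
      then show ?thesis using kernel_norm_eq_0[OF n, of z 0] by simp
    qed
    have "\<bar>average n u (r\<^sup>2) 0\<bar> \<le> (LINT z|lborel. \<bar>u (r\<^sup>2 *\<^sub>R z) * kernel n ((norm z)\<^sup>2)\<bar>)"
      unfolding average_def add_0 by (rule integral_abs_bound)
    also have "\<dots> \<le> (LINT z::'a|lborel. C * ln r * \<bar>kernel n ((norm z)\<^sup>2)\<bar>)"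
      using integrable_abs_kernel[OF n continuous_u, of 0]
      by (intro integral_mono integrable_abs int le) auto
    finally show ?thesis by (simp add: mult_ac)
  qed
  then show ?thesis by blast
qed

text \<open>At scale r^2 a translation by a vector of length r is a relative shift of size 1 / r.
  Moving the shift from \<open>u\<close> to the kernel makes it act on one fixed continuous
  function, while \<open>u\<close> divided by ln r stays bounded; dominated convergence then
  applies.\<close>

lemma average_shift:
  assumes X: "\<And>k. norm (X k) \<ge> real k + 2"
  defines "r \<equiv> \<lambda>k. norm (X k)"
  shows "(\<lambda>k. (average n u ((r k)\<^sup>2) (X k) - average n u ((r k)\<^sup>2) 0) / ln (r k)) \<longlonglongrightarrow> 0"
proof -
  obtain C where C: "C > 0" "\<And>r y. r \<ge> 2 \<Longrightarrow> norm y \<le> 2 * r\<^sup>2 + r \<Longrightarrow> \<bar>u y\<bar> \<le> C * ln r"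
    using u_log_bound by blast
  have r: "r k \<ge> 2" "r k > 0" for k using X[of k] by (auto simp: r_def)
  have top: "filterlim r at_top sequentially"
    by (rule filterlim_at_top_mono[OF filterlim_real_sequentially])
      (auto intro!: always_eventually order_trans[OF _ X] simp: r_def)
  \<comment> \<open>The centre in units of the scale r^2.\<close>
  define a where "a k = X k /\<^sub>R (r k)\<^sup>2" for k
  have norm_a: "norm (a k) = inverse (r k)" for k
  proof -
    have "norm (a k) = inverse ((r k)\<^sup>2) * r k" by (simp add: a_def r_def)
    then show ?thesis using r(2)[of k] by (simp add: power2_eq_square)
  qed
  have norm_a_le: "norm (a k) \<le> 1" for k
    unfolding norm_a using r[of k] by (simp add: inverse_le_1_iff)
  have a: "a \<longlonglongrightarrow> 0"
    by (rule tendsto_norm_zero_cancel) (simp only: norm_a tendsto_inverse_0_at_top[OF top])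
  define U where "U k w = u ((r k)\<^sup>2 *\<^sub>R w)" for k w
  define \<kappa> where "\<kappa> b w = kernel n ((norm (w - b))\<^sup>2)" for b w :: 'a
  have U: "continuous_on UNIV (U k)" for k
    unfolding U_def[abs_def] by (intro continuous_on_compose2[OF continuous_u] continuous_intros) auto
  have int: "integrable lborel (\<lambda>w. U k w * \<kappa> b w)" for k b
    unfolding \<kappa>_def by (rule integrable_kernel_mult[OF n U])
  have [measurable]: "(\<lambda>w. U k w * \<kappa> b w) \<in> borel_measurable borel" for k b
    using borel_measurable_integrable[OF int] by simp
  have shift: "average n u ((r k)\<^sup>2) (X k) = (LINT w|lborel. U k w * \<kappa> (a k) w)" for k
  proof -
    have "(LINT w|lborel. U k w * \<kappa> (a k) w) = (LINT z|lborel. U k (a k + z) * \<kappa> (a k) (a k + z))"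
      by (subst lborel_integral_affine[where s = 1 and a = "a k"]) auto
    also have "\<dots> = average n u ((r k)\<^sup>2) (X k)"
      using r(2)[of k] by (simp add: average_def U_def \<kappa>_def a_def scaleR_add_right)
    finally show ?thesis ..
  qed
  have centre: "average n u ((r k)\<^sup>2) 0 = (LINT w|lborel. U k w * \<kappa> 0 w)" for k
    by (simp add: average_def U_def \<kappa>_def)
  define F where "F k w = U k w / ln (r k) * (\<kappa> (a k) w - \<kappa> 0 w)" for k w
  have F: "(average n u ((r k)\<^sup>2) (X k) - average n u ((r k)\<^sup>2) 0) / ln (r k) = (LINT w|lborel. F k w)" for k
  proof -
    have "(LINT w|lborel. F k w) = (LINT w|lborel. (U k w * \<kappa> (a k) w - U k w * \<kappa> 0 w) / ln (r k))"
      by (intro Bochner_Integration.integral_cong) (auto simp: F_def diff_divide_distrib algebra_simps)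
    also have "\<dots> = ((LINT w|lborel. U k w * \<kappa> (a k) w) - (LINT w|lborel. U k w * \<kappa> 0 w)) / ln (r k)"
      by (simp add: Bochner_Integration.integral_diff[OF int int])
    finally show ?thesis by (simp add: shift centre)
  qed
  \<comment> \<open>The radius 9 = 3^2 covers |w - b| \<le> 3, which follows from |w| \<le> 2 and
    |b| \<le> 1.\<close>
  obtain Q where Q: "Q > 0" "\<And>t. t \<in> cball 0 9 \<Longrightarrow> \<bar>kernel n t\<bar> \<le> Q"
    using continuous_bounded_on_cball[OF continuous_on_kernel] by blast
  have \<kappa>_le: "\<bar>\<kappa> b w\<bar> \<le> Q" if "norm b \<le> 1" "norm w \<le> 2" for b w :: 'a
  proof -
    have "norm (w - b) \<le> 3" using norm_triangle_ineq4[of w b] that by linarith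
    then have "(norm (w - b))\<^sup>2 \<le> 3\<^sup>2" by (intro power_mono) auto
    then show ?thesis unfolding \<kappa>_def by (intro Q(2)) auto
  qed
  have \<kappa>_0: "\<kappa> b w = 0" if "norm b \<le> 1" "norm w > 2" for b w :: 'a
  proof -
    have "norm (w - b) > 1" using norm_triangle_ineq2[of w b] that by linarith
    then show ?thesis unfolding \<kappa>_def by (intro kernel_norm_eq_0[OF n]) (auto simp: dist_norm norm_minus_commute)
  qed
  have F_le: "\<bar>F k w\<bar> \<le> C * \<bar>\<kappa> (a k) w - \<kappa> 0 w\<bar>" for k w
  proof (cases "norm w \<le> 2")
    case True
    then have "(r k)\<^sup>2 * norm w \<le> (r k)\<^sup>2 * 2" by (intro mult_left_mono) auto
    also have "\<dots> \<le> 2 * (r k)\<^sup>2 + r k" using r[of k] by simp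
    finally have "\<bar>U k w\<bar> \<le> C * ln (r k)"
      unfolding U_def using r[of k] by (intro C(2)) auto
    then have "\<bar>U k w / ln (r k)\<bar> \<le> C"
      using r[of k] by (simp add: abs_divide divide_le_eq)
    then show ?thesis unfolding F_def abs_mult by (rule mult_right_mono) simp
  next
    case False
    then show ?thesis using \<kappa>_0[OF norm_a_le, of w k] \<kappa>_0[of 0 w] by (simp add: F_def)
  qed
  have "(\<lambda>k. LINT w|lborel. F k w) \<longlonglongrightarrow> (LINT w::'a|lborel. 0)"
  proof (rule integral_dominated_convergence[where w = "\<lambda>w. indicator (cball 0 2) w * (C * (2 * Q))"])
    have "emeasure lborel (cball (0::'a) 2) < \<infinity>"
      using emeasure_bounded_finite[OF bounded_cball] by simp
    then show "integrable lborel (\<lambda>w::'a. indicator (cball 0 2) w * (C * (2 * Q)))"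
      by auto
    show "AE w in lborel. (\<lambda>k. F k w) \<longlonglongrightarrow> 0"
    proof (rule AE_I2)
      fix w :: 'a
      have "continuous_on UNIV (\<lambda>b. \<kappa> b w)"
        unfolding \<kappa>_def by (rule continuous_on_compose2[OF continuous_on_kernel]) (auto intro!: continuous_intros)
      then have "isCont (\<lambda>b. \<kappa> b w) 0" by (simp add: continuous_on_eq_continuous_at)
      from tendsto_mult_right_zero[where c = C, OF tendsto_rabs_zero[OF LIM_zero[OF isCont_tendsto_compose[OF this a]]]]
      show "(\<lambda>k. F k w) \<longlonglongrightarrow> 0"
        by (rule Lim_null_comparison[rotated]) (use F_le in auto)
    qed
    show "AE w in lborel. norm (F k w) \<le> indicator (cball 0 2) w * (C * (2 * Q))" for k
    proof (rule AE_I2)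
      fix w :: 'a
      show "norm (F k w) \<le> indicator (cball 0 2) w * (C * (2 * Q))"
      proof (cases "norm w \<le> 2")
        case True
        then have "\<bar>\<kappa> (a k) w - \<kappa> 0 w\<bar> \<le> 2 * Q"
          using \<kappa>_le[OF norm_a_le[of k] True] \<kappa>_le[of 0 w] by simp
        then have "C * \<bar>\<kappa> (a k) w - \<kappa> 0 w\<bar> \<le> C * (2 * Q)"
          using C(1) by (intro mult_left_mono) auto
        with True F_le[of k w] show ?thesis by simp
      next
        case False
        then show ?thesis using \<kappa>_0[OF norm_a_le, of w k] \<kappa>_0[of 0 w] by (simp add: F_def)
      qed
    qed
    show "F k \<in> borel_measurable lborel" for k
    proof -
      have "continuous_on UNIV (F k)"
        unfolding F_def[abs_def] \<kappa>_def using r[of k]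
        by (intro continuous_intros U continuous_on_kernel_norm) auto
      then show ?thesis by (simp add: borel_measurable_continuous_onI)
    qed
  qed simp
  then show ?thesis unfolding F by simp
qed

section \<open>Asymptotic formula and integrability\<close>

lemma tlog_integral_limit:
  assumes int: "integrable lborel f" and r: "\<And>k. r k \<ge> 2"
    and s: "\<And>k. 1 / (r k + 3) ^ q \<le> s k" "\<And>k. s k \<le> 1"
    and lim: "\<And>y. (\<lambda>k. tlog (s k) ((r k)\<^sup>2) (x k) y / ln (r k)) \<longlonglongrightarrow> c"
  shows "(\<lambda>k. (LINT y|lborel. f y * tlog (s k) ((r k)\<^sup>2) (x k) y) / ln (r k)) \<longlonglongrightarrow>
    c * (LINT y|lborel. f y)"
proof -
  obtain M where M: "\<And>t. t \<in> {0..1} \<Longrightarrow> \<bar>smooth_ln t\<bar> \<le> M"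
    using smooth_ln_bounded by blast
  define T where "T k y = tlog (s k) ((r k)\<^sup>2) (x k) y / ln (r k)" for k y
  have T: "\<bar>T k y\<bar> \<le> M / ln 2 + 2 + 3 * real q" for k y
    unfolding T_def by (intro abs_tlog_div_ln_le M r s)
  have [measurable]: "T k \<in> borel_measurable borel" for k
    unfolding T_def[abs_def] by measurable
  have "(\<lambda>k. LINT y|lborel. f y * T k y) \<longlonglongrightarrow> (LINT y|lborel. f y * c)"
  proof (rule integral_dominated_convergence[where w = "\<lambda>y. \<bar>f y\<bar> * (M / ln 2 + 2 + 3 * real q)"])
    show "AE y in lborel. (\<lambda>k. f y * T k y) \<longlonglongrightarrow> f y * c"
      unfolding T_def by (intro AE_I2 tendsto_intros lim)
    show "AE y in lborel. norm (f y * T k y) \<le> \<bar>f y\<bar> * (M / ln 2 + 2 + 3 * real q)" for k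
      using T by (auto simp: abs_mult intro!: mult_left_mono)
    show "integrable lborel (\<lambda>y. \<bar>f y\<bar> * (M / ln 2 + 2 + 3 * real q))"
      using int by (intro integrable_mult_left integrable_abs)
  qed auto
  then show ?thesis by (simp add: T_def mult.commute)
qed

lemma gamma_const_pos: "gamma_const n > 0"
  by (simp add: gamma_const_closed_form[OF n])

lemma asymptotics:
  assumes int: "integrable lborel f"
  shows "((\<lambda>x. u x / ln (norm x)) \<longlongrightarrow> - ((LINT y|lborel. f y) / gamma_const n)) at_infinity"
proof (rule tendsto_at_infinity_sequentiallyI[where c = 2])
  fix X :: "nat \<Rightarrow> 'a"
  assume X: "norm (X k) \<ge> real k + 2" for k
  define r where "r k = norm (X k)" for k
  define \<Lambda> where "\<Lambda> = (LINT y|lborel. f y)"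
  have r: "r k \<ge> real k + 2" "r k \<ge> 2" for k using X[of k] by (simp_all add: r_def)
  have top: "filterlim r at_top sequentially"
    by (rule filterlim_at_top_mono[OF filterlim_real_sequentially])
      (auto intro!: always_eventually order_trans[OF _ r(1)])
  obtain D q where D: "\<And>x. \<bar>gamma_const n * u x - average n u (1 / (norm x + 3) ^ q) x\<bar> \<le> D"
    using average_near by blast
  define s where "s k = 1 / (r k + 3) ^ q" for k
  have s: "0 < s k" "s k \<le> 1" for k
    using r(2)[of k] one_le_power[of "r k + 3" q] by (auto simp: s_def)
  have "(\<lambda>k. (gamma_const n * u (X k) - average n u (s k) (X k)) / ln (r k)) \<longlonglongrightarrow> 0"
    by (rule tendsto_divide_ln[OF top, where B = D]) (simp add: D s_def r_def)
  moreover have "(\<lambda>k. (LINT y|lborel. f y * tlog (s k) ((r k)\<^sup>2) (X k) y) / ln (r k)) \<longlonglongrightarrow> 1 * \<Lambda>"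
    unfolding \<Lambda>_def
    by (rule tlog_integral_limit[OF int r(2), where q = q])
      (use s tlog_moving_limit[OF X s] in \<open>simp_all add: s_def r_def\<close>)
  moreover have "(\<lambda>k. (average n u ((r k)\<^sup>2) (X k) - average n u ((r k)\<^sup>2) 0) / ln (r k)) \<longlonglongrightarrow> 0"
    unfolding r_def by (rule average_shift[OF X])
  moreover have "(\<lambda>k. average n u 1 0 / ln (r k)) \<longlonglongrightarrow> 0"
    by (rule tendsto_divide_ln[OF top, where B = "\<bar>average n u 1 0\<bar>"]) simp
  \<comment> \<open>Here the inner scale is constantly 1, so q = 0 meets the required lower
    bound.\<close>
  moreover have "(\<lambda>k. (LINT y|lborel. f y * tlog 1 ((r k)\<^sup>2) 0 y) / ln (r k)) \<longlonglongrightarrow> 2 * \<Lambda>"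
    unfolding \<Lambda>_def
    by (rule tlog_integral_limit[OF int r(2), where q = 0])
      (use tlog_centred_limit[OF r(1)] in simp_all)
  \<comment> \<open>By \<open>average_diff\<close> all averages in this sum telescope, leaving only
    \<open>gamma_const n * u (X k)\<close>. The moving centre contributes \<Lambda> and the fixed
    one 2 \<Lambda>, which combine to -\<Lambda>.\<close>
  ultimately have "(\<lambda>k. (gamma_const n * u (X k) - average n u (s k) (X k)) / ln (r k)
      + (LINT y|lborel. f y * tlog (s k) ((r k)\<^sup>2) (X k) y) / ln (r k)
      + (average n u ((r k)\<^sup>2) (X k) - average n u ((r k)\<^sup>2) 0) / ln (r k)
      + average n u 1 0 / ln (r k)
      - (LINT y|lborel. f y * tlog 1 ((r k)\<^sup>2) 0 y) / ln (r k)) \<longlonglongrightarrow> 0 + 1 * \<Lambda> + 0 + 0 - 2 * \<Lambda>"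
    by (intro tendsto_add tendsto_diff)
  moreover have "(gamma_const n * u (X k) - average n u (s k) (X k)) / ln (r k)
      + (LINT y|lborel. f y * tlog (s k) ((r k)\<^sup>2) (X k) y) / ln (r k)
      + (average n u ((r k)\<^sup>2) (X k) - average n u ((r k)\<^sup>2) 0) / ln (r k)
      + average n u 1 0 / ln (r k)
      - (LINT y|lborel. f y * tlog 1 ((r k)\<^sup>2) 0 y) / ln (r k)
      = gamma_const n * u (X k) / ln (r k)" for k
  proof -
    have "(r k)\<^sup>2 > 0" using r(2)[of k] by simp
    then show ?thesis
      using s[of k] by (simp add: average_diff[symmetric] diff_divide_distrib)
  qed
  ultimately have "(\<lambda>k. gamma_const n * u (X k) / ln (r k)) \<longlonglongrightarrow> - \<Lambda>"
    by simp
  from tendsto_divide[OF this tendsto_const[of "gamma_const n"]]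
  show "(\<lambda>k. u (X k) / ln (norm (X k))) \<longlonglongrightarrow> - ((LINT y|lborel. f y) / gamma_const n)"
    using gamma_const_pos by (simp add: r_def \<Lambda>_def)
qed

text \<open>Testing with \<open>tlog 1 (r\<^sup>2) 0\<close> and dividing by \<open>ln r\<close>: the left-hand side stays bounded since
  \<open>u = O(ln)\<close>, while the weights tend to \<open>2\<close>, so Fatou applies where the density has a sign.\<close>

lemma integrable_if_constant_sign:
  assumes "constant_sign_at_infinity K"
  shows "integrable lborel f"
proof -
  obtain R where R: "R > 0" "(\<forall>x. norm x \<ge> R \<longrightarrow> K x \<ge> 0) \<or> (\<forall>x. norm x \<ge> R \<longrightarrow> K x \<le> 0)"
    using assms by (auto simp: constant_sign_at_infinity_def)
  obtain \<sigma> :: real where \<sigma>: "\<bar>\<sigma>\<bar> = 1" "\<And>x. norm x \<ge> R \<Longrightarrow> \<sigma> * K x \<ge> 0"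
  proof (cases "\<forall>x. norm x \<ge> R \<longrightarrow> K x \<ge> 0")
    case True
    then show ?thesis by (intro that[of 1]) auto
  next
    case False
    then show ?thesis using R(2) by (intro that[of "-1"]) auto
  qed
  \<comment> \<open>Beyond radius R the sign of \<open>K\<close> is fixed; beyond radius 1 the
    weight \<open>tlog 1\<close> around 0 is nonnegative.\<close>
  define S where "S = {x::'a. max R 1 \<le> norm x}"
  define h where "h y = \<sigma> * f y * indicator S y" for y
  have [measurable]: "S \<in> sets borel" unfolding S_def by measurable
  have h: "h y \<ge> 0" for y
    using \<sigma>(2)[of y] by (auto simp: h_def f_def S_def mult.assoc[symmetric] split: split_indicator)
  have inside: "integrable lborel (\<lambda>y. indicator (cball 0 (max R 1)) y *\<^sub>R f y)"
    by (intro borel_integrable_compact continuous_on_subset[OF continuous_f]) auto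
  have ball: "integrable lborel (\<lambda>y. f y * indicator (- S) y)"
    by (rule Bochner_Integration.integrable_bound[OF inside])
      (auto simp: S_def split: split_indicator)
  define r where "r k = real k + 2" for k
  have r: "r k \<ge> 2" for k by (simp add: r_def)
  have lnr: "ln (r k) > 0" "(r k)\<^sup>2 \<ge> 1" for k
    using r[of k] one_le_power[of "r k" 2] by auto
  define T where "T k y = tlog 1 ((r k)\<^sup>2) 0 y / ln (r k)" for k and y :: 'a
  have [measurable]: "T k \<in> borel_measurable borel" for k
    unfolding T_def[abs_def] by measurable
  obtain M where M: "\<And>t. t \<in> {0..1} \<Longrightarrow> \<bar>smooth_ln t\<bar> \<le> M"
    using smooth_ln_bounded by blast
  define N where "N = M / ln 2 + 2"
  have T: "\<bar>T k y\<bar> \<le> N" for k y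
    unfolding T_def N_def using abs_tlog_div_ln_le[OF M r, where q = 0 and s = 1] by simp
  obtain C where C: "\<And>r. r \<ge> 2 \<Longrightarrow> \<bar>average n u (r\<^sup>2) 0\<bar> \<le> C * ln r"
    using average_centred_bound by blast
  have fT: "integrable lborel (\<lambda>y. f y * T k y)" for k
    unfolding T_def times_divide_eq_right using less_le_trans[OF zero_less_one lnr(2)[of k]]
    by (intro integrable_divide integrable_f_tlog) simp
  have fT_le: "\<bar>LINT y|lborel. f y * T k y\<bar> \<le> \<bar>average n u 1 0\<bar> / ln 2 + C" for k
  proof -
    have "(LINT y|lborel. f y * T k y) = (average n u 1 0 - average n u ((r k)\<^sup>2) 0) / ln (r k)"
      using average_diff[OF zero_less_one less_le_trans[OF zero_less_one lnr(2)[of k]], of 0]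
      by (simp add: T_def)
    moreover have "\<bar>average n u 1 0 / ln (r k)\<bar> \<le> \<bar>average n u 1 0\<bar> / ln 2"
      using lnr[of k] r[of k] by (simp add: abs_divide) (intro divide_left_mono ln_mono mult_pos_pos; simp)
    moreover have "\<bar>average n u ((r k)\<^sup>2) 0 / ln (r k)\<bar> \<le> C"
      using lnr[of k] C[OF r[of k]] by (simp add: abs_divide divide_le_eq)
    ultimately show ?thesis unfolding diff_divide_distrib by linarith
  qed
  have fT_in: "integrable lborel (\<lambda>y. f y * indicator (- S) y * T k y)" for k
    by (rule Bochner_Integration.integrable_bound[OF fT[of k]]) (auto split: split_indicator)
  have fT_in_le: "\<bar>LINT y|lborel. f y * indicator (- S) y * T k y\<bar> \<le>
      (LINT y|lborel. \<bar>f y * indicator (- S) y\<bar> * N)" for k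
  proof -
    have "\<bar>LINT y|lborel. f y * indicator (- S) y * T k y\<bar> \<le>
        (LINT y|lborel. \<bar>f y * indicator (- S) y * T k y\<bar>)"
      by (rule integral_abs_bound)
    also have "\<dots> \<le> (LINT y|lborel. \<bar>f y * indicator (- S) y\<bar> * N)"
      using fT_in ball T by (intro integral_mono integrable_mult_left integrable_abs)
        (auto simp: abs_mult intro!: mult_mono)
    finally show ?thesis .
  qed
  \<comment> \<open>The sign-corrected part on \<open>S\<close> is the full integrand minus its part
    off \<open>S\<close>, and both integrals are bounded uniformly in k.\<close>
  have hT: "h y * T k y = \<sigma> * (f y * T k y - f y * indicator (- S) y * T k y)" for k y
    by (simp add: h_def indicator_def)
  have "integrable lborel (\<lambda>y. h y * 2)"
  proof (rule integrable_Fatou[where g = "\<lambda>k y. h y * T k y"])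
    show "integrable lborel (\<lambda>y. h y * T k y)" for k
      unfolding hT by (intro integrable_mult_right Bochner_Integration.integrable_diff fT fT_in)
    show "h y * T k y \<ge> 0" for k y
    proof (cases "y \<in> S")
      case True
      then show ?thesis
        unfolding T_def using lnr[of k] h[of y]
        by (intro mult_nonneg_nonneg divide_nonneg_nonneg tlog_nonneg) (auto simp: S_def)
    qed (simp add: h_def)
    show "(LINT y|lborel. h y * T k y) \<le> \<bar>average n u 1 0\<bar> / ln 2 + C
        + (LINT y|lborel. \<bar>f y * indicator (- S) y\<bar> * N)" for k
    proof -
      have "(LINT y|lborel. h y * T k y) =
          \<sigma> * ((LINT y|lborel. f y * T k y) - (LINT y|lborel. f y * indicator (- S) y * T k y))"
        unfolding hT by (simp add: Bochner_Integration.integral_diff[OF fT fT_in])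
      also have "\<dots> \<le> \<bar>\<dots>\<bar>" by (rule abs_ge_self)
      also have "\<dots> \<le> \<bar>LINT y|lborel. f y * T k y\<bar> + \<bar>LINT y|lborel. f y * indicator (- S) y * T k y\<bar>"
        unfolding abs_mult \<sigma>(1) by simp
      finally show ?thesis using fT_le[of k] fT_in_le[of k] by linarith
    qed
    show "(\<lambda>k. h y * T k y) \<longlonglongrightarrow> h y * 2" for y
      unfolding T_def by (intro tendsto_intros tlog_centred_limit) (simp add: r_def)
  qed (simp add: h_def[abs_def])
  \<comment> \<open>The factor 1 / 2 removes the limiting weight 2, and multiplying by \<sigma> once
    more undoes the sign correction since \<sigma>^2 = 1.\<close>
  then have "integrable lborel (\<lambda>y. \<sigma> * (1 / 2 * (h y * 2)) + f y * indicator (- S) y)"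
    by (intro Bochner_Integration.integrable_add integrable_mult_right ball)
  also have "(\<lambda>y. \<sigma> * (1 / 2 * (h y * 2)) + f y * indicator (- S) y) = f"
  proof
    have "\<sigma> * \<sigma> = 1" using \<sigma>(1) by (metis abs_mult_self_eq mult_1)
    then show "\<sigma> * (1 / 2 * (h y * 2)) + f y * indicator (- S) y = f y" for y
      by (simp add: h_def mult.assoc[symmetric] split: split_indicator)
  qed
  finally show ?thesis .
qed

end

theorem theorem1p2:
  fixes n :: nat and K u :: "'a::euclidean_space \<Rightarrow> real"
  assumes "n \<ge> 1" and "DIM('a) = 2 * n"
    and "continuous_on UNIV K" and "\<exists>x. K x \<noteq> 0"
    and "\<exists>C>0. \<exists>l\<ge>0. \<forall>x. \<bar>K x\<bar> \<le> C * (norm x powr l + 1)"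
    and "conformal_solution n K u"
    and "u \<in> O[at_infinity](\<lambda>x. ln (norm x))"
  shows "(constant_sign_at_infinity K \<longrightarrow>
            integrable lborel (\<lambda>x. K x * exp (2 * real n * u x))) \<and>
         (integrable lborel (\<lambda>x. K x * exp (2 * real n * u x)) \<longrightarrow>
            ((\<lambda>x. u x / ln (norm x)) \<longlongrightarrow>
               - (total_curvature n K u / gamma_const n)) at_infinity)"
proof -
  interpret conformal_equation n K u
    using assms by unfold_locales
  have "f = (\<lambda>x. K x * exp (2 * real n * u x))"
    by (simp add: f_def[abs_def])
  then show ?thesis
    using integrable_if_constant_sign asymptotics unfolding total_curvature_def by simp
qed

end
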